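(* Let $(f,g):\mathcal{C}(1)\to\mathcal{C}(2)$ be a morphism of exact couples of $R$-modules such that for $s\in\{1,2\}$ (writing $E_r^{p,q}$ for the object of the $r$-th page in position $(p,q)$): (1) the associated spectral sequences satisfy $E_r^{p,q}(s)=0$ for all $r\geq 2$ whenever $p<0$ or $q<0$; (2) for $r\geq 2$ the differential $d_r(s)$ on $E_r(s)$ has bidegree $(r,-r+1)$; (3) the $E_\infty$-objects match the limit abutment: $L^n(s)=0$ for $n<0$ and, for each $n\geq 0$, the canonical filtration of $L^n(s)$ has the form $$0=F^{n,0}(s)\subseteq F^{n-1,1}(s)\subseteq\cdots\subseteq F^{0,n}(s)\subseteq F^{-1,n+1}(s)=L^n(s),$$ with short exact sequences $0\to F^{p,q}(s)\to F^{p-1,q+1}(s)\to E_\infty^{p,q}(s)\to 0$ for $p+q=n$, compatible with the maps induced by $(f,g)$. Assume further: (i) The induced map of limit abutment objects $L^n(f):L^n(1)\to L^n(2)$ is an isomorphism for all $n\in\mathbb{Z}$. (ii) $f_2^{0,0}:E_2^{0,0}(1)\to E_2^{0,0}(2)$ is an isomorphism. (iii) For every $n\geq0$: if $f_2^{0,q}:E_2^{0,q}(1)\to E_2^{0,q}(2)$ is an isomorphism for $0\leq q\leq n$, then $f_2^{p,q}$ is an isomorphism for all $(p,q)$ with $q\leq n$ and all $p\in\mathbb{Z}$. Then the induced map $(f_r\mid r\geq 2)$ of spectral sequences is an isomorphism.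
   Context: $R$ is a unital ring. A $(\mathbb{Z}\times\mathbb{Z})$-bigraded exact couple $(E,D,i,j,k)$ with bidegrees $\mathbf{a},\mathbf{b},\mathbf{c}\in\mathbb{Z}\times\mathbb{Z}$ consists of families of $R$-modules $D_{\mathbf{x}},E_{\mathbf{x}}$ ($\mathbf{x}\in\mathbb{Z}\times\mathbb{Z}$) and $R$-linear maps $i_{\mathbf{x}}:D_{\mathbf{x}}\to D_{\mathbf{x}+\mathbf{a}}$, $j_{\mathbf{x}}:D_{\mathbf{x}}\to E_{\mathbf{x}+\mathbf{b}}$, $k_{\mathbf{x}}:E_{\mathbf{x}}\to D_{\mathbf{x}+\mathbf{c}}$ such that $D_{\mathbf{x}-\mathbf{a}}\xrightarrow{i}D_{\mathbf{x}}\xrightarrow{j}E_{\mathbf{x}+\mathbf{b}}\xrightarrow{k}D_{\mathbf{x}+\mathbf{b}+\mathbf{c}}\xrightarrow{i}D_{\mathbf{x}+\mathbf{a}+\mathbf{b}+\mathbf{c}}$ is exact for all $\mathbf{x}$. A morphism $(f,g)$ of exact couples with equal bidegrees is a pair of families $f_{\mathbf{x}}:D_{\mathbf{x}}(1)\to D_{\mathbf{x}}(2)$, $g_{\mathbf{x}}:E_{\mathbf{x}}(1)\to E_{\mathbf{x}}(2)$ commuting with $i,j,k$. Associated spectral sequence: with $i^r$ the $r$-fold composite of $i$, put $Z_{r}^{\mathbf{x}+\mathbf{b}}=k^{-1}(\operatorname{im}\,i^{r}_{\mathbf{x}+\mathbf{b}+\mathbf{c}-r\mathbf{a}})$, $B_r^{\mathbf{x}+\mathbf{b}}=j(\ker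 i^r_{\mathbf{x}})$, $E_{r+1}=Z_r/B_r$ for $r\ge 0$; $d_r$ on $E_r$ sends the class of $e$ to the class of $j(y)$ where $i^{r-1}(y)=k(e)$; it has bidegree $\mathbf{b}+\mathbf{c}-(r-1)\mathbf{a}$, and $E_{r+1}$ is the homology of $(E_r,d_r)$. $E_\infty:=\bigcap_rZ_r/\bigcup_rB_r$. A morphism of exact couples induces a morphism $f_r:E_r(1)\to E_r(2)$ of spectral sequences ($r\leq\infty$). Condition (2) forces $\mathbf{a}=(-1,1)$ and $\mathbf{b}+\mathbf{c}=(1,0)$. The limit abutment $L^n$ is the limit of the diagram $\cdots\to D_{\mathbf{x}-\mathbf{a}}\xrightarrow{i}D_{\mathbf{x}}\xrightarrow{i}D_{\mathbf{x}+\mathbf{a}}\to\cdots$ of the $D_{\mathbf{x}}$ with $\mathbf{x}=(p,q)$, $p+q=n$ (indexing by total degree); its canonical filtration is by the kernels of the cone maps $L^n\to D_{\mathbf{x}}$. A morphism of exact couples induces filtration-preserving maps $L^n(f):L^n(1)\to L^n(2)$. *)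

theory Defs
  imports "HOL-Algebra.AbelCoset" "HOL-Algebra.Module" "HOL-Library.Product_Plus"
begin

section \<open>Modules over a ring that need not be commutative\<close>

text \<open>The library locale \<open>module\<close> asks for a commutative ring; everything else is taken over
  verbatim. The module record of the library is reused, so \<open>mult\<close> and \<open>one\<close> of a module carry no
  meaning; they are left \<open>undefined\<close> in the modules constructed below.\<close>

locale left_module = R?: ring R + M?: abelian_group M
  for R (structure) and M :: "('r, 'm) module" (structure) +
  assumes smult_closed:
      "\<lbrakk>a \<in> carrier R; x \<in> carrier M\<rbrakk> \<Longrightarrow> a \<odot>\<^bsub>M\<^esub> x \<in> carrier M"
    and smult_l_distr:
      "\<lbrakk>a \<in> carrier R; b \<in> carrier R; x \<in> carrier M\<rbrakk> \<Longrightarrow>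
        (a \<oplus> b) \<odot>\<^bsub>M\<^esub> x = a \<odot>\<^bsub>M\<^esub> x \<oplus>\<^bsub>M\<^esub> b \<odot>\<^bsub>M\<^esub> x"
    and smult_r_distr:
      "\<lbrakk>a \<in> carrier R; x \<in> carrier M; y \<in> carrier M\<rbrakk> \<Longrightarrow>
        a \<odot>\<^bsub>M\<^esub> (x \<oplus>\<^bsub>M\<^esub> y) = a \<odot>\<^bsub>M\<^esub> x \<oplus>\<^bsub>M\<^esub> a \<odot>\<^bsub>M\<^esub> y"
    and smult_assoc:
      "\<lbrakk>a \<in> carrier R; b \<in> carrier R; x \<in> carrier M\<rbrakk> \<Longrightarrow>
        (a \<otimes> b) \<odot>\<^bsub>M\<^esub> x = a \<odot>\<^bsub>M\<^esub> (b \<odot>\<^bsub>M\<^esub> x)"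
    and smult_one:
      "x \<in> carrier M \<Longrightarrow> \<one> \<odot>\<^bsub>M\<^esub> x = x"

definition linear_maps ::
    "('r, 'x) ring_scheme \<Rightarrow> ('r, 'm) module \<Rightarrow> ('r, 'n) module \<Rightarrow> ('m \<Rightarrow> 'n) set" where
  "linear_maps R M N = {h \<in> carrier M \<rightarrow> carrier N.
     (\<forall>x\<in>carrier M. \<forall>y\<in>carrier M. h (x \<oplus>\<^bsub>M\<^esub> y) = h x \<oplus>\<^bsub>N\<^esub> h y) \<and>
     (\<forall>a\<in>carrier R. \<forall>x\<in>carrier M. h (a \<odot>\<^bsub>M\<^esub> x) = a \<odot>\<^bsub>N\<^esub> h x)}"

definition linear_iso ::
    "('r, 'x) ring_scheme \<Rightarrow> ('r, 'm) module \<Rightarrow> ('r, 'n) module \<Rightarrow> ('m \<Rightarrow> 'n) \<Rightarrow> bool" where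
  "linear_iso R M N h \<longleftrightarrow> h \<in> linear_maps R M N \<and> bij_betw h (carrier M) (carrier N)"

definition zero_module :: "('r, 'm) module \<Rightarrow> bool" where
  "zero_module M \<longleftrightarrow> carrier M = {\<zero>\<^bsub>M\<^esub>}"

text \<open>\<open>coset_map N B h\<close> sends a coset \<open>X\<close> to the coset \<open>h z + B\<close> in \<open>N\<close>, for any \<open>z \<in> X\<close>. The union
  avoids a choice: whenever \<open>h\<close> is compatible with the cosets, it is a union of equal sets.\<close>

definition coset_map :: "('r, 'n) module \<Rightarrow> 'n set \<Rightarrow> ('m \<Rightarrow> 'n) \<Rightarrow> 'm set \<Rightarrow> 'n set" where
  "coset_map N B h X = (\<Union>z\<in>X. B +>\<^bsub>N\<^esub> h z)"

definition subquotient :: "('r, 'm) module \<Rightarrow> 'm set \<Rightarrow> 'm set \<Rightarrow> ('r, 'm set) module" where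
  "subquotient M Z B =
     \<lparr> carrier = (\<lambda>z. B +>\<^bsub>M\<^esub> z) ` Z, mult = undefined, one = undefined,
       zero = B, add = set_add M,
       smult = (\<lambda>a. coset_map M B (\<lambda>z. a \<odot>\<^bsub>M\<^esub> z)) \<rparr>"

section \<open>Bigraded exact couples\<close>

text \<open>All modules \<open>D\<^sub>x\<close> live on one type, and so do all \<open>E\<^sub>x\<close>. This is no restriction: a family
  of modules can be placed on the disjoint union of their carriers.\<close>

record ('r, 'd, 'e) couple =
  Dmod :: "int \<times> int \<Rightarrow> ('r, 'd) module"
  Emod :: "int \<times> int \<Rightarrow> ('r, 'e) module"
  imap :: "int \<times> int \<Rightarrow> 'd \<Rightarrow> 'd"
  jmap :: "int \<times> int \<Rightarrow> 'd \<Rightarrow> 'e"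
  kmap :: "int \<times> int \<Rightarrow> 'e \<Rightarrow> 'd"
  adeg :: "int \<times> int"
  bdeg :: "int \<times> int"
  cdeg :: "int \<times> int"

locale exact_couple = ring R
  for R :: "('r, 'x) ring_scheme" and C :: "('r, 'd, 'e) couple" +
  assumes D_module: "left_module R (Dmod C x)"
    and E_module: "left_module R (Emod C x)"
    and i_linear: "imap C x \<in> linear_maps R (Dmod C x) (Dmod C (x + adeg C))"
    and j_linear: "jmap C x \<in> linear_maps R (Dmod C x) (Emod C (x + bdeg C))"
    and k_linear: "kmap C x \<in> linear_maps R (Emod C x) (Dmod C (x + cdeg C))"
    and exact_ij:
      "imap C (x - adeg C) ` carrier (Dmod C (x - adeg C)) =
       a_kernel (Dmod C x) (Emod C (x + bdeg C)) (jmap C x)"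
    and exact_jk:
      "jmap C x ` carrier (Dmod C x) =
       a_kernel (Emod C (x + bdeg C)) (Dmod C (x + bdeg C + cdeg C)) (kmap C (x + bdeg C))"
    and exact_ki:
      "kmap C (x + bdeg C) ` carrier (Emod C (x + bdeg C)) =
       a_kernel (Dmod C (x + bdeg C + cdeg C)) (Dmod C (x + adeg C + bdeg C + cdeg C))
         (imap C (x + bdeg C + cdeg C))"

locale exact_couple_morphism =
  C1: exact_couple R C1 + C2: exact_couple R C2
  for R :: "('r, 'x) ring_scheme"
    and C1 :: "('r, 'd1, 'e1) couple" and C2 :: "('r, 'd2, 'e2) couple" +
  fixes f :: "int \<times> int \<Rightarrow> 'd1 \<Rightarrow> 'd2" and g :: "int \<times> int \<Rightarrow> 'e1 \<Rightarrow> 'e2"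
  assumes degrees: "adeg C1 = adeg C2" "bdeg C1 = bdeg C2" "cdeg C1 = cdeg C2"
    and f_linear: "f x \<in> linear_maps R (Dmod C1 x) (Dmod C2 x)"
    and g_linear: "g x \<in> linear_maps R (Emod C1 x) (Emod C2 x)"
    and commute_i: "u \<in> carrier (Dmod C1 x) \<Longrightarrow> f (x + adeg C1) (imap C1 x u) = imap C2 x (f x u)"
    and commute_j: "u \<in> carrier (Dmod C1 x) \<Longrightarrow> g (x + bdeg C1) (jmap C1 x u) = jmap C2 x (f x u)"
    and commute_k: "e \<in> carrier (Emod C1 x) \<Longrightarrow> f (x + cdeg C1) (kmap C1 x e) = kmap C2 x (g x e)"

section \<open>The associated spectral sequence\<close>

definition deg_times :: "nat \<Rightarrow> int \<times> int \<Rightarrow> int \<times> int" where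
  "deg_times r x = (int r * fst x, int r * snd x)"

text \<open>\<open>ipow C r x\<close> is the composite \<open>D\<^sub>x \<rightarrow> D\<^sub>x\<^sub>+\<^sub>r\<^sub>a\<close> of \<open>r\<close> maps \<open>i\<close>.\<close>

primrec ipow :: "('r, 'd, 'e) couple \<Rightarrow> nat \<Rightarrow> int \<times> int \<Rightarrow> 'd \<Rightarrow> 'd" where
  "ipow C 0 x u = u"
| "ipow C (Suc r) x u = imap C (x + deg_times r (adeg C)) (ipow C r x u)"

definition Zsub :: "('r, 'd, 'e) couple \<Rightarrow> nat \<Rightarrow> int \<times> int \<Rightarrow> 'e set" where
  "Zsub C r x = {e \<in> carrier (Emod C x).
     kmap C x e \<in> ipow C r (x + cdeg C - deg_times r (adeg C)) `
                    carrier (Dmod C (x + cdeg C - deg_times r (adeg C)))}"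

definition Bsub :: "('r, 'd, 'e) couple \<Rightarrow> nat \<Rightarrow> int \<times> int \<Rightarrow> 'e set" where
  "Bsub C r x = jmap C (x - bdeg C) `
     a_kernel (Dmod C (x - bdeg C)) (Dmod C (x - bdeg C + deg_times r (adeg C)))
       (ipow C r (x - bdeg C))"

text \<open>The pages are numbered from 1, with \<open>E\<^sub>r = Z\<^sub>r\<^sub>-\<^sub>1 / B\<^sub>r\<^sub>-\<^sub>1\<close>; the value at \<open>r = 0\<close> is
  irrelevant.\<close>

definition page :: "('r, 'd, 'e) couple \<Rightarrow> nat \<Rightarrow> int \<times> int \<Rightarrow> ('r, 'e set) module" where
  "page C r x = subquotient (Emod C x) (Zsub C (r - 1) x) (Bsub C (r - 1) x)"

definition page_class :: "('r, 'd, 'e) couple \<Rightarrow> nat \<Rightarrow> int \<times> int \<Rightarrow> 'e \<Rightarrow> 'e set" where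
  "page_class C r x z = Bsub C (r - 1) x +>\<^bsub>Emod C x\<^esub> z"

definition diff_deg :: "('r, 'd, 'e) couple \<Rightarrow> nat \<Rightarrow> int \<times> int" where
  "diff_deg C r = bdeg C + cdeg C - deg_times (r - 1) (adeg C)"

text \<open>The differential: the class of \<open>e\<close> goes to the class of \<open>j y\<close> whenever \<open>i\<^sup>r\<^sup>-\<^sup>1 y = k e\<close>. As in
  \<open>coset_map\<close>, the union runs over equal sets, one for each choice of \<open>e\<close> and \<open>y\<close>.\<close>

definition diff :: "('r, 'd, 'e) couple \<Rightarrow> nat \<Rightarrow> int \<times> int \<Rightarrow> 'e set \<Rightarrow> 'e set" where
  "diff C r x X =
     \<Union>{page_class C r (x + diff_deg C r) (jmap C (x + cdeg C - deg_times (r - 1) (adeg C)) y) | y e.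
         e \<in> X \<and> y \<in> carrier (Dmod C (x + cdeg C - deg_times (r - 1) (adeg C))) \<and>
         ipow C (r - 1) (x + cdeg C - deg_times (r - 1) (adeg C)) y = kmap C x e}"

definition Binf :: "('r, 'd, 'e) couple \<Rightarrow> int \<times> int \<Rightarrow> 'e set" where
  "Binf C x = (\<Union>r. Bsub C r x)"

definition page_inf :: "('r, 'd, 'e) couple \<Rightarrow> int \<times> int \<Rightarrow> ('r, 'e set) module" where
  "page_inf C x = subquotient (Emod C x) (\<Inter>r. Zsub C r x) (Binf C x)"

text \<open>The maps on pages induced by the second component \<open>g\<close> of a morphism into \<open>C2\<close>.\<close>

definition page_map ::
    "('r, 'd2, 'e2) couple \<Rightarrow> (int \<times> int \<Rightarrow> 'e1 \<Rightarrow> 'e2) \<Rightarrow> nat \<Rightarrow> int \<times> int \<Rightarrow> 'e1 set \<Rightarrow> 'e2 set" where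
  "page_map C2 g r x = coset_map (Emod C2 x) (Bsub C2 (r - 1) x) (g x)"

definition page_inf_map ::
    "('r, 'd2, 'e2) couple \<Rightarrow> (int \<times> int \<Rightarrow> 'e1 \<Rightarrow> 'e2) \<Rightarrow> int \<times> int \<Rightarrow> 'e1 set \<Rightarrow> 'e2 set" where
  "page_inf_map C2 g x = coset_map (Emod C2 x) (Binf C2 x) (g x)"

text \<open>Morphisms of the associated spectral sequences, from page \<open>r0\<close> on. The last condition says
  that \<open>\<phi>\<^sub>r\<^sub>+\<^sub>1\<close> is the map induced by \<open>\<phi>\<^sub>r\<close> under the identification of \<open>E\<^sub>r\<^sub>+\<^sub>1\<close> with the homology
  of \<open>E\<^sub>r\<close>: the class of \<open>z \<in> Z\<^sub>r\<close> in \<open>E\<^sub>r\<^sub>+\<^sub>1\<close> is the homology class of the cycle represented by \<open>z\<close>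
  in \<open>E\<^sub>r\<close>.\<close>

definition spectral_sequence_morphism ::
    "('r, 'x) ring_scheme \<Rightarrow> ('r, 'd1, 'e1) couple \<Rightarrow> ('r, 'd2, 'e2) couple \<Rightarrow> nat \<Rightarrow>
     (nat \<Rightarrow> int \<times> int \<Rightarrow> 'e1 set \<Rightarrow> 'e2 set) \<Rightarrow> bool" where
  "spectral_sequence_morphism R C1 C2 r0 \<phi> \<longleftrightarrow>
     (\<forall>r\<ge>r0. diff_deg C1 r = diff_deg C2 r \<and>
       (\<forall>x. \<phi> r x \<in> linear_maps R (page C1 r x) (page C2 r x) \<and>
         (\<forall>X\<in>carrier (page C1 r x).
            \<phi> r (x + diff_deg C1 r) (diff C1 r x X) = diff C2 r x (\<phi> r x X)) \<and>
         (\<forall>z\<in>Zsub C1 r x. \<forall>w\<in>Zsub C2 r x.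
            \<phi> r x (page_class C1 r x z) = page_class C2 r x w \<longrightarrow>
            \<phi> (Suc r) x (page_class C1 (Suc r) x z) = page_class C2 (Suc r) x w)))"

definition spectral_sequence_iso ::
    "('r, 'x) ring_scheme \<Rightarrow> ('r, 'd1, 'e1) couple \<Rightarrow> ('r, 'd2, 'e2) couple \<Rightarrow> nat \<Rightarrow>
     (nat \<Rightarrow> int \<times> int \<Rightarrow> 'e1 set \<Rightarrow> 'e2 set) \<Rightarrow> bool" where
  "spectral_sequence_iso R C1 C2 r0 \<phi> \<longleftrightarrow>
     spectral_sequence_morphism R C1 C2 r0 \<phi> \<and>
     (\<forall>r\<ge>r0. \<forall>x. linear_iso R (page C1 r x) (page C2 r x) (\<phi> r x))"

section \<open>The limit abutment\<close>

definition antidiagonal :: "int \<Rightarrow> (int \<times> int) set" where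
  "antidiagonal n = {x. fst x + snd x = n}"

text \<open>The limit of the sequence of the \<open>D\<^sub>x\<close> of total degree \<open>n\<close>, as the module of compatible
  families. It is meant for \<open>a = (-1, 1)\<close> (or \<open>(1, -1)\<close>), when \<open>i\<close> runs along the antidiagonal
  through all its points.\<close>

definition limit_abutment ::
    "('r, 'd, 'e) couple \<Rightarrow> int \<Rightarrow> ('r, int \<times> int \<Rightarrow> 'd) module" where
  "limit_abutment C n =
     \<lparr> carrier = {v \<in> (\<Pi>\<^sub>E x\<in>antidiagonal n. carrier (Dmod C x)).
                   \<forall>x\<in>antidiagonal n. imap C x (v x) = v (x + adeg C)},
       mult = undefined, one = undefined,
       zero = (\<lambda>x\<in>antidiagonal n. \<zero>\<^bsub>Dmod C x\<^esub>),
       add = (\<lambda>v w. \<lambda>x\<in>antidiagonal n. v x \<oplus>\<^bsub>Dmod C x\<^esub> w x),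
       smult = (\<lambda>a v. \<lambda>x\<in>antidiagonal n. a \<odot>\<^bsub>Dmod C x\<^esub> v x) \<rparr>"

definition limit_map ::
    "(int \<times> int \<Rightarrow> 'd1 \<Rightarrow> 'd2) \<Rightarrow> int \<Rightarrow> (int \<times> int \<Rightarrow> 'd1) \<Rightarrow> (int \<times> int \<Rightarrow> 'd2)" where
  "limit_map f n v = (\<lambda>x\<in>antidiagonal n. f x (v x))"

text \<open>The canonical filtration of \<open>L\<^sup>n\<close>, \<open>n = p + q\<close>, consists of the kernels of the cone maps
  \<open>L\<^sup>n \<rightarrow> D\<^sub>x\<close> with \<open>x\<close> of total degree \<open>n\<close>. The filtration is indexed by the points of an
  antidiagonal only up to a translation, and \<open>t\<close> says where the index starts: the step \<open>F\<^sup>p\<^sup>,\<^sup>q\<close>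
  is the kernel of the map to \<open>D\<close> at \<open>(p + t, q - t)\<close>. If \<open>k\<close> has bidegree \<open>(t, -t)\<close>, this \<open>t\<close>
  is the value for which \<open>k\<close> relates the step from \<open>F\<^sup>p\<^sup>,\<^sup>q\<close> to \<open>F\<^sup>p\<^sup>-\<^sup>1\<^sup>,\<^sup>q\<^sup>+\<^sup>1\<close> to position \<open>(p, q)\<close>
  of the spectral sequence; \<open>t = 0\<close> for \<open>k\<close> of bidegree \<open>(0, 0)\<close>.\<close>

definition filtration ::
    "('r, 'd, 'e) couple \<Rightarrow> int \<Rightarrow> int \<times> int \<Rightarrow> (int \<times> int \<Rightarrow> 'd) set" where
  "filtration C t = (\<lambda>(p, q).
     a_kernel (limit_abutment C (p + q)) (Dmod C (p + t, q - t)) (\<lambda>v. v (p + t, q - t)))"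

text \<open>The \<open>E\<^sub>\<infinity>\<close>-objects match the limit abutment: \<open>\<pi> (p, q)\<close> is the map from \<open>F\<^sup>p\<^sup>-\<^sup>1\<^sup>,\<^sup>q\<^sup>+\<^sup>1\<close> onto
  \<open>E\<^sub>\<infinity>\<^sup>p\<^sup>,\<^sup>q\<close> in the short exact sequence; the map from \<open>F\<^sup>p\<^sup>,\<^sup>q\<close> is the inclusion.\<close>

definition matches_limit_abutment ::
    "('r, 'x) ring_scheme \<Rightarrow> ('r, 'd, 'e) couple \<Rightarrow> int \<Rightarrow>
     (int \<times> int \<Rightarrow> (int \<times> int \<Rightarrow> 'd) \<Rightarrow> 'e set) \<Rightarrow> bool" where
  "matches_limit_abutment R C t \<pi> \<longleftrightarrow>
     (\<forall>n<0. zero_module (limit_abutment C n)) \<and>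
     (\<forall>n\<ge>0.
        filtration C t (n, 0) = {\<zero>\<^bsub>limit_abutment C n\<^esub>} \<and>
        filtration C t (-1, n + 1) = carrier (limit_abutment C n) \<and>
        (\<forall>p\<ge>0. \<forall>q\<ge>0. p + q = n \<longrightarrow>
           filtration C t (p, q) \<subseteq> filtration C t (p - 1, q + 1) \<and>
           \<pi> (p, q) \<in> linear_maps R
             (limit_abutment C n \<lparr> carrier := filtration C t (p - 1, q + 1) \<rparr>)
             (page_inf C (p, q)) \<and>
           \<pi> (p, q) ` filtration C t (p - 1, q + 1) = carrier (page_inf C (p, q)) \<and>
           a_kernel (limit_abutment C n \<lparr> carrier := filtration C t (p - 1, q + 1) \<rparr>)
             (page_inf C (p, q)) (\<pi> (p, q)) = filtration C t (p, q)))"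

end

theory Submission
  imports Defs
begin

text \<open>
  This is a Zeeman comparison theorem in which the left column of the second page is recovered from
  the abutment. By induction on \<open>n\<close>, the map \<open>f\<^sub>2\<close> is bijective in all rows \<open>q \<le> n\<close>. The corner
  hypothesis starts the induction, and by the propagation hypothesis it suffices in the step to
  treat the single position \<open>(0, n + 1)\<close> (\<open>corner_of_next_row\<close>).

  From page 2 to infinity: \<open>d\<^sub>r\<close> goes down by \<open>r - 1\<close> rows, so diagram chases from one page to the
  next show that \<open>f\<^sub>r\<close> stays surjective in all rows \<open>q \<le> n\<close> and stays injective in the rows
  \<open>q \<le> n + 2 - r\<close> (\<open>page_rows\<close>). Injectivity is lost from row \<open>n\<close> downwards, since differentials
  arrive from row \<open>n + 1\<close>, about which nothing is known. Surjectivity survives on \<open>E\<^sub>\<infinity>\<close>, where it can be compared with the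
  abutment. Starting from \<open>F\<^sup>k\<^sup>,\<^sup>0 = 0\<close>, each step of the filtration of \<open>L\<^sup>k\<close> is mapped onto its
  counterpart as long as the quotients \<open>E\<^sub>\<infinity>\<close> are (\<open>filtration_surj_below\<close>). Since \<open>L\<^sup>k\<close> maps bijectively, a step
  that is hit entirely forces injectivity on the next quotient (\<open>page_inj_of_filtration\<close>), and
  the top step gives surjectivity on the last one. In total degree \<open>n + 1\<close> this makes
  \<open>f\<^sub>\<infinity>\<^sup>0\<^sup>,\<^sup>n\<^sup>+\<^sup>1\<close> bijective; in total degree \<open>n + 2\<close> it makes \<open>f\<^sub>\<infinity>\<close> injective at the positions
  \<open>(r, n + 2 - r)\<close>, the targets of the differentials that leave \<open>(0, n + 1)\<close>. After page \<open>r\<close> nothing enters such a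
  target, so \<open>f\<^sub>r\<^sub>+\<^sub>1\<close> is injective there already.

  From infinity back to page 2: no differential enters \<open>(0, n + 1)\<close>, so \<open>E\<^sub>r\<^sub>+\<^sub>1\<close> is there the kernel
  of \<open>d\<^sub>r\<close>. The four lemma for
  \<open>0 \<rightarrow> E\<^sub>r\<^sub>+\<^sub>1\<^sup>0\<^sup>,\<^sup>n\<^sup>+\<^sup>1 \<rightarrow> E\<^sub>r\<^sup>0\<^sup>,\<^sup>n\<^sup>+\<^sup>1 \<rightarrow> ker d\<^sub>r \<rightarrow> E\<^sub>r\<^sub>+\<^sub>1\<^sup>r\<^sup>,\<^sup>n\<^sup>+\<^sup>2\<^sup>-\<^sup>r\<close> carries bijectivity from page
  \<open>r + 1\<close> to page \<open>r\<close> (\<open>page_inj_descend\<close>, \<open>page_surj_descend\<close>).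

  Once \<open>f\<^sub>2\<close> is bijective everywhere, the chases of \<open>page_rows\<close> give the same for every \<open>f\<^sub>r\<close>.

  All chases are carried out on representatives: the page \<open>E\<^sub>m\<^sub>+\<^sub>1\<close> is handled through its cycles
  \<open>Z\<^sub>m\<close>, its boundaries \<open>B\<^sub>m\<close> and the relation \<open>diff_rel\<close> induced by \<open>d\<^sub>m\<^sub>+\<^sub>1\<close> on elements of \<open>E\<close>.
  The index \<open>m\<close> always stands for page \<open>m + 1\<close>.
\<close>

section \<open>Linear maps and subquotients\<close>

lemma linear_mapsD:
  assumes "h \<in> linear_maps R M N"
  shows "x \<in> carrier M \<Longrightarrow> h x \<in> carrier N"
    and "x \<in> carrier M \<Longrightarrow> y \<in> carrier M \<Longrightarrow> h (x \<oplus>\<^bsub>M\<^esub> y) = h x \<oplus>\<^bsub>N\<^esub> h y"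
    and "a \<in> carrier R \<Longrightarrow> x \<in> carrier M \<Longrightarrow> h (a \<odot>\<^bsub>M\<^esub> x) = a \<odot>\<^bsub>N\<^esub> h x"
  using assms by (auto simp: linear_maps_def)

lemma additive_imp_group_hom:
  assumes "abelian_group M" "abelian_group N"
    and "\<And>x. x \<in> carrier M \<Longrightarrow> h x \<in> carrier N"
    and "\<And>x y. x \<in> carrier M \<Longrightarrow> y \<in> carrier M \<Longrightarrow> h (x \<oplus>\<^bsub>M\<^esub> y) = h x \<oplus>\<^bsub>N\<^esub> h y"
  shows "abelian_group_hom M N h"
proof (rule abelian_group_homI)
  show "group_hom (add_monoid M) (add_monoid N) h"
    using assms
    by (intro group_hom.intro group_hom_axioms.intro abelian_group.a_group homI) auto
qed fact+

lemma linear_maps_group_hom: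
  assumes "abelian_group M" "abelian_group N" "h \<in> linear_maps R M N"
  shows "abelian_group_hom M N h"
  using assms by (intro additive_imp_group_hom) (auto dest: linear_mapsD)

lemma (in abelian_group_hom) hom_minus:
  assumes "x \<in> carrier G" "y \<in> carrier G"
  shows "h (x \<ominus>\<^bsub>G\<^esub> y) = h x \<ominus>\<^bsub>H\<^esub> h y"
  using assms by (simp add: a_minus_def)

lemma linear_maps_comp:
  assumes "h \<in> linear_maps R L M" "h' \<in> linear_maps R M N"
  shows "(\<lambda>x. h' (h x)) \<in> linear_maps R L N"
  using assms by (auto simp: linear_maps_def Pi_iff)

lemma submodule_additive: "submodule H R M \<Longrightarrow> additive_subgroup H M"
  by (simp add: submodule_def additive_subgroup_def)

lemma submodule_abelian_subgroup:
  "submodule H R M \<Longrightarrow> abelian_group M \<Longrightarrow> abelian_subgroup H M"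
  by (intro abelian_subgroupI3 submodule_additive)

lemma submodule_minus_closed:
  assumes "submodule H R M" "x \<in> H" "y \<in> H"
  shows "x \<ominus>\<^bsub>M\<^esub> y \<in> H"
proof -
  interpret additive_subgroup H M using assms(1) by (rule submodule_additive)
  show ?thesis using assms by (auto simp: a_minus_def)
qed

context left_module begin

lemma smult_group_hom:
  assumes "a \<in> carrier R" shows "abelian_group_hom M M (\<lambda>x. a \<odot>\<^bsub>M\<^esub> x)"
  using assms by (intro additive_imp_group_hom M.abelian_group_axioms smult_r_distr smult_closed)

lemma submoduleI:
  assumes "H \<subseteq> carrier M" "\<zero>\<^bsub>M\<^esub> \<in> H"
    and add: "\<And>x y. x \<in> H \<Longrightarrow> y \<in> H \<Longrightarrow> x \<oplus>\<^bsub>M\<^esub> y \<in> H"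
    and smult: "\<And>a x. a \<in> carrier R \<Longrightarrow> x \<in> H \<Longrightarrow> a \<odot>\<^bsub>M\<^esub> x \<in> H"
  shows "submodule H R M"
proof -
  have inv: "\<ominus>\<^bsub>M\<^esub> x \<in> H" if "x \<in> H" for x
  proof -
    have x: "x \<in> carrier M" using that assms by auto
    have "(\<ominus> \<one>) \<odot>\<^bsub>M\<^esub> x \<oplus>\<^bsub>M\<^esub> x = (\<ominus> \<one> \<oplus> \<one>) \<odot>\<^bsub>M\<^esub> x"
      using x by (simp add: smult_l_distr smult_one)
    also have "\<dots> = \<zero>\<^bsub>M\<^esub>"
    proof -
      have "\<zero> \<odot>\<^bsub>M\<^esub> x \<oplus>\<^bsub>M\<^esub> \<zero> \<odot>\<^bsub>M\<^esub> x = \<zero> \<odot>\<^bsub>M\<^esub> x"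
        using x by (simp flip: smult_l_distr)
      then show ?thesis using x smult_closed[OF R.zero_closed x] by (simp add: R.l_neg)
    qed
    finally have "\<ominus>\<^bsub>M\<^esub> x = (\<ominus> \<one>) \<odot>\<^bsub>M\<^esub> x"
      using x by (intro M.minus_equality) (auto intro: smult_closed)
    then show ?thesis using smult[OF _ that] by simp
  qed
  have "subgroup H (add_monoid M)"
    using assms inv by (intro group.subgroupI[OF M.a_group]) (auto simp flip: a_inv_def)
  then show ?thesis using smult by (simp add: submodule_def submodule_axioms_def)
qed

end

lemma (in abelian_subgroup) coset_eq_iff:
  assumes "x \<in> carrier G" "y \<in> carrier G"
  shows "H +> x = H +> y \<longleftrightarrow> x \<ominus> y \<in> H"
proof -
  have "H +> x = H +> y \<longleftrightarrow> x \<in> H +> y"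
    using assms a_repr_independence'[of x y] a_rcos_self[of x] by auto
  then show ?thesis using assms a_rcos_module_minus[OF _ assms(2,1)] abelian_group_axioms
    by (simp add: a_rcos_module a_minus_def)
qed

lemma (in abelian_subgroup) coset_eq_self_iff:
  assumes "x \<in> carrier G" shows "H +> x = H \<longleftrightarrow> x \<in> H"
  using assms a_rcos_self a_rcos_const by auto

text \<open>Any two representatives of a coset differ by an element of \<open>B\<close>, which \<open>h\<close> sends into \<open>B'\<close>. So the
  union in \<open>coset_map\<close> is a union of copies of one and the same coset.\<close>

lemma coset_map_coset:
  assumes h: "abelian_group_hom M N h" and B: "additive_subgroup B M"
    and B': "additive_subgroup B' N" and hB: "h ` B \<subseteq> B'" and z: "z \<in> carrier M"
  shows "coset_map N B' h (B +>\<^bsub>M\<^esub> z) = B' +>\<^bsub>N\<^esub> h z"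
proof -
  interpret h: abelian_group_hom M N h by (rule h)
  interpret B: abelian_subgroup B M using B h.G.abelian_group_axioms by (rule abelian_subgroupI3)
  interpret B': abelian_subgroup B' N using B' h.H.abelian_group_axioms by (rule abelian_subgroupI3)
  have "B' +>\<^bsub>N\<^esub> h w = B' +>\<^bsub>N\<^esub> h z" if w: "w \<in> B +>\<^bsub>M\<^esub> z" for w
  proof -
    have wc: "w \<in> carrier M" using B.a_elemrcos_carrier z w by blast
    have "w \<ominus>\<^bsub>M\<^esub> z \<in> B" using w z wc by (simp add: B.a_rcos_module a_minus_def)
    then have "h w \<ominus>\<^bsub>N\<^esub> h z \<in> B'" using hB h.hom_minus[OF wc z] by force
    then show ?thesis using wc z by (simp add: B'.coset_eq_iff)
  qed
  then show ?thesis using B.a_rcos_self[OF z] unfolding coset_map_def by blast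
qed

lemma zero_module_subquotient_iff:
  assumes M: "abelian_group M" and B: "additive_subgroup B M" and Z: "additive_subgroup Z M"
    and "B \<subseteq> Z"
  shows "zero_module (subquotient M Z B) \<longleftrightarrow> Z \<subseteq> B"
proof -
  interpret B: abelian_subgroup B M using B M by (rule abelian_subgroupI3)
  interpret Z: additive_subgroup Z M by fact
  have "Z \<noteq> {}" using Z.zero_closed by blast
  have "zero_module (subquotient M Z B) \<longleftrightarrow> (\<forall>z\<in>Z. B +>\<^bsub>M\<^esub> z = B)"
    using \<open>Z \<noteq> {}\<close> by (auto simp: zero_module_def subquotient_def image_constant_conv)
  then show ?thesis using Z.a_Hcarr by (auto simp: B.coset_eq_self_iff)
qed

lemma submodule_cong:
  assumes "submodule H R M" "abelian_group M" "x \<in> carrier M" "y \<in> carrier M" "x \<ominus>\<^bsub>M\<^esub> y \<in> H"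
  shows "x \<in> H \<longleftrightarrow> y \<in> H"
proof -
  interpret abelian_subgroup H M using assms(1,2) by (rule submodule_abelian_subgroup)
  show ?thesis using assms coset_eq_iff coset_eq_self_iff by metis
qed

lemma abelian_group_minus_add:
  assumes "abelian_group M" "x \<in> carrier M" "y \<in> carrier M" "z \<in> carrier M"
  shows "x \<ominus>\<^bsub>M\<^esub> (y \<oplus>\<^bsub>M\<^esub> z) = (x \<ominus>\<^bsub>M\<^esub> y) \<ominus>\<^bsub>M\<^esub> z"
proof -
  interpret abelian_group M by fact
  show ?thesis using assms by (simp add: a_minus_def minus_add a_assoc)
qed

text \<open>Surjectivity and injectivity of the map \<open>Z / B \<rightarrow> Z' / B'\<close> induced by \<open>h\<close>, read off from
  representatives.\<close>

definition surj_mod where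
  "surj_mod N Z Z' B' h \<longleftrightarrow> (\<forall>z'\<in>Z'. \<exists>z\<in>Z. z' \<ominus>\<^bsub>N\<^esub> h z \<in> B')"

definition inj_mod where
  "inj_mod Z B B' h \<longleftrightarrow> (\<forall>z\<in>Z. h z \<in> B' \<longrightarrow> z \<in> B)"

locale subquotient_hom =
  M: left_module R M + N: left_module R N
  for R :: "('r, 'x) ring_scheme" and M :: "('r, 'm) module" and N :: "('r, 'n) module" +
  fixes Z B Z' B' h
  assumes h_linear: "h \<in> linear_maps R M N"
    and Z: "submodule Z R M" and B: "submodule B R M" and B_le_Z: "B \<subseteq> Z"
    and Z': "submodule Z' R N" and B': "submodule B' R N" and B'_le_Z': "B' \<subseteq> Z'"
    and hZ: "h ` Z \<subseteq> Z'" and hB: "h ` B \<subseteq> B'"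
begin

lemmas Z_additive = submodule_additive[OF Z] and B_additive = submodule_additive[OF B]
  and Z'_additive = submodule_additive[OF Z'] and B'_additive = submodule_additive[OF B']

sublocale h: abelian_group_hom M N h
  by (rule linear_maps_group_hom[OF M.abelian_group_axioms N.abelian_group_axioms h_linear])
sublocale B: abelian_subgroup B M
  by (rule submodule_abelian_subgroup[OF B M.abelian_group_axioms])
sublocale B': abelian_subgroup B' N
  by (rule submodule_abelian_subgroup[OF B' N.abelian_group_axioms])

lemma Z_carrier: "z \<in> Z \<Longrightarrow> z \<in> carrier M" and Z'_carrier: "z' \<in> Z' \<Longrightarrow> z' \<in> carrier N"
  using additive_subgroup.a_Hcarr[OF Z_additive] additive_subgroup.a_Hcarr[OF Z'_additive] by auto

lemma coset_map_eq: "z \<in> carrier M \<Longrightarrow> coset_map N B' h (B +>\<^bsub>M\<^esub> z) = B' +>\<^bsub>N\<^esub> h z"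
  by (rule coset_map_coset[OF h.is_abelian_group_hom B_additive B'_additive hB])

lemma smult_coset:
  "a \<in> carrier R \<Longrightarrow> z \<in> carrier M \<Longrightarrow>
     a \<odot>\<^bsub>subquotient M Z B\<^esub> (B +>\<^bsub>M\<^esub> z) = B +>\<^bsub>M\<^esub> (a \<odot>\<^bsub>M\<^esub> z)"
  "a \<in> carrier R \<Longrightarrow> z' \<in> carrier N \<Longrightarrow>
     a \<odot>\<^bsub>subquotient N Z' B'\<^esub> (B' +>\<^bsub>N\<^esub> z') = B' +>\<^bsub>N\<^esub> (a \<odot>\<^bsub>N\<^esub> z')"
  using submodule.smult_closed[OF B] submodule.smult_closed[OF B']
    coset_map_coset[OF M.smult_group_hom B_additive B_additive]
    coset_map_coset[OF N.smult_group_hom B'_additive B'_additive]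
  by (auto simp: subquotient_def image_subset_iff)

lemma coset_map_linear:
  "coset_map N B' h \<in> linear_maps R (subquotient M Z B) (subquotient N Z' B')"
proof -
  have car: "carrier (subquotient M Z B) = (\<lambda>z. B +>\<^bsub>M\<^esub> z) ` Z"
    "carrier (subquotient N Z' B') = (\<lambda>z. B' +>\<^bsub>N\<^esub> z) ` Z'"
    and add: "add (subquotient M Z B) = set_add M" "add (subquotient N Z' B') = set_add N"
    by (auto simp: subquotient_def)
  show ?thesis unfolding linear_maps_def car add
  proof (intro CollectI conjI ballI)
    show "coset_map N B' h \<in> (+>\<^bsub>M\<^esub>) B ` Z \<rightarrow> (+>\<^bsub>N\<^esub>) B' ` Z'"
      using hZ by (auto simp: coset_map_eq Z_carrier)
  next
    fix X Y assume "X \<in> (+>\<^bsub>M\<^esub>) B ` Z" "Y \<in> (+>\<^bsub>M\<^esub>) B ` Z"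
    then show "coset_map N B' h (X <+>\<^bsub>M\<^esub> Y) = coset_map N B' h X <+>\<^bsub>N\<^esub> coset_map N B' h Y"
      by (auto simp: coset_map_eq Z_carrier B.a_rcos_sum B'.a_rcos_sum)
  next
    fix a X assume "a \<in> carrier R" "X \<in> (+>\<^bsub>M\<^esub>) B ` Z"
    then show "coset_map N B' h (a \<odot>\<^bsub>subquotient M Z B\<^esub> X) =
        a \<odot>\<^bsub>subquotient N Z' B'\<^esub> coset_map N B' h X"
      using linear_mapsD(3)[OF h_linear]
      by (auto simp: coset_map_eq Z_carrier smult_coset M.smult_closed)
  qed
qed

lemma surj_iff:
  "coset_map N B' h ` carrier (subquotient M Z B) = carrier (subquotient N Z' B')
     \<longleftrightarrow> surj_mod N Z Z' B' h"
proof -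
  have "coset_map N B' h ` carrier (subquotient M Z B) = (\<lambda>z. B' +>\<^bsub>N\<^esub> h z) ` Z"
    by (force simp: subquotient_def coset_map_eq Z_carrier image_image)
  moreover have "(\<lambda>z. B' +>\<^bsub>N\<^esub> h z) ` Z \<subseteq> carrier (subquotient N Z' B')"
    using hZ by (auto simp: subquotient_def)
  moreover have "carrier (subquotient N Z' B') \<subseteq> (\<lambda>z. B' +>\<^bsub>N\<^esub> h z) ` Z
      \<longleftrightarrow> (\<forall>z'\<in>Z'. \<exists>z\<in>Z. B' +>\<^bsub>N\<^esub> z' = B' +>\<^bsub>N\<^esub> h z)"
    by (force simp: subquotient_def)
  ultimately show ?thesis
    unfolding surj_mod_def using B'.coset_eq_iff Z_carrier Z'_carrier h.hom_closed
    by (smt (verit, best) bex_cong ball_cong subset_antisym subset_refl)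
qed

lemma inj_iff: "inj_on (coset_map N B' h) (carrier (subquotient M Z B)) \<longleftrightarrow> inj_mod Z B B' h"
proof
  assume inj: "inj_on (coset_map N B' h) (carrier (subquotient M Z B))"
  show "inj_mod Z B B' h" unfolding inj_mod_def
  proof (intro ballI impI)
    fix z assume z: "z \<in> Z" "h z \<in> B'"
    have "\<zero>\<^bsub>M\<^esub> \<in> Z" using Z_additive by (rule additive_subgroup.zero_closed)
    moreover have "coset_map N B' h (B +>\<^bsub>M\<^esub> z) = coset_map N B' h (B +>\<^bsub>M\<^esub> \<zero>\<^bsub>M\<^esub>)"
      using z by (simp add: coset_map_eq Z_carrier B'.coset_eq_iff a_minus_def)
    ultimately have "B +>\<^bsub>M\<^esub> z = B +>\<^bsub>M\<^esub> \<zero>\<^bsub>M\<^esub>"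
      using z by (intro inj_onD[OF inj]) (auto simp: subquotient_def)
    then have "B +>\<^bsub>M\<^esub> z = B" by (simp add: B.a_rcos_const)
    then show "z \<in> B" using z by (simp add: B.coset_eq_self_iff Z_carrier)
  qed
next
  assume inj: "inj_mod Z B B' h"
  show "inj_on (coset_map N B' h) (carrier (subquotient M Z B))"
  proof (rule inj_onI)
    fix X Y assume "X \<in> carrier (subquotient M Z B)" "Y \<in> carrier (subquotient M Z B)"
      and eq: "coset_map N B' h X = coset_map N B' h Y"
    then obtain z w where zw: "z \<in> Z" "w \<in> Z" "X = B +>\<^bsub>M\<^esub> z" "Y = B +>\<^bsub>M\<^esub> w"
      by (auto simp: subquotient_def)
    have "h z \<ominus>\<^bsub>N\<^esub> h w \<in> B'"
      using eq zw by (simp add: coset_map_eq Z_carrier B'.coset_eq_iff)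
    then have "h (z \<ominus>\<^bsub>M\<^esub> w) \<in> B'" using zw by (simp add: h.hom_minus Z_carrier)
    then have "z \<ominus>\<^bsub>M\<^esub> w \<in> B"
      using inj zw submodule_minus_closed[OF Z] by (auto simp: inj_mod_def)
    then show "X = Y" using zw by (simp add: B.coset_eq_iff Z_carrier)
  qed
qed

lemma linear_iso_iff:
  "linear_iso R (subquotient M Z B) (subquotient N Z' B') (coset_map N B' h)
     \<longleftrightarrow> surj_mod N Z Z' B' h \<and> inj_mod Z B B' h"
  unfolding linear_iso_def bij_betw_def by (auto simp: coset_map_linear surj_iff inj_iff)

end

section \<open>The differentials as relations between representatives\<close>

lemma deg_times_0 [simp]: "deg_times 0 a = 0"
  and deg_times_Suc: "deg_times (Suc r) a = deg_times r a + a"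
  by (simp_all add: deg_times_def prod_eq_iff algebra_simps)

text \<open>The differential \<open>d\<^sub>m\<^sub>+\<^sub>1\<close> as an additive relation on \<open>E\<close>: it relates \<open>e\<close> to every \<open>j y\<close> with
  \<open>i\<^sup>m y = k e\<close>. The lemmas \<open>Zsub_iff_diff_rel\<close>, \<open>diff_rel_Bsub_iff\<close> and \<open>Bsub_Suc_iff_diff_rel\<close> below
  identify its domain, its kernel and its image, and so contain the fact that \<open>E\<^sub>m\<^sub>+\<^sub>2\<close> is the
  homology of \<open>E\<^sub>m\<^sub>+\<^sub>1\<close>.\<close>

definition diff_rel :: "('r, 'd, 'e) couple \<Rightarrow> nat \<Rightarrow> int \<times> int \<Rightarrow> 'e \<Rightarrow> 'e \<Rightarrow> bool" where
  "diff_rel C m x e e' \<longleftrightarrow> e \<in> carrier (Emod C x) \<and>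
     (\<exists>y\<in>carrier (Dmod C (x + cdeg C - deg_times m (adeg C))).
        ipow C m (x + cdeg C - deg_times m (adeg C)) y = kmap C x e \<and>
        e' = jmap C (x + cdeg C - deg_times m (adeg C)) y)"

lemma diff_deg_Suc: "diff_deg C (Suc m) = bdeg C + cdeg C - deg_times m (adeg C)"
  by (simp add: diff_deg_def)

context exact_couple begin

lemma D_group: "abelian_group (Dmod C x)" and E_group: "abelian_group (Emod C x)"
  using D_module E_module by (auto simp: left_module_def)

lemma i_hom: "abelian_group_hom (Dmod C x) (Dmod C (x + adeg C)) (imap C x)"
  and j_hom: "abelian_group_hom (Dmod C x) (Emod C (x + bdeg C)) (jmap C x)"
  and k_hom: "abelian_group_hom (Emod C x) (Dmod C (x + cdeg C)) (kmap C x)"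
  by (rule linear_maps_group_hom[OF D_group D_group i_linear]
      linear_maps_group_hom[OF D_group E_group j_linear]
      linear_maps_group_hom[OF E_group D_group k_linear])+

lemma ipow_linear: "ipow C r x \<in> linear_maps R (Dmod C x) (Dmod C (x + deg_times r (adeg C)))"
proof (induction r)
  case 0 show ?case by (simp add: linear_maps_def)
next
  case (Suc r)
  from linear_maps_comp[OF Suc i_linear] show ?case by (simp add: deg_times_Suc add.assoc)
qed

lemma ipow_hom: "abelian_group_hom (Dmod C x) (Dmod C (x + deg_times r (adeg C))) (ipow C r x)"
  by (rule linear_maps_group_hom[OF D_group D_group ipow_linear])

lemma ipow_Suc_left: "ipow C (Suc r) x u = ipow C r (x + adeg C) (imap C x u)"
  by (induction r) (simp_all add: deg_times_Suc algebra_simps)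

lemma i_closed: "u \<in> carrier (Dmod C x) \<Longrightarrow> imap C x u \<in> carrier (Dmod C (x + adeg C))"
  and j_closed: "u \<in> carrier (Dmod C x) \<Longrightarrow> jmap C x u \<in> carrier (Emod C (x + bdeg C))"
  and k_closed: "e \<in> carrier (Emod C x) \<Longrightarrow> kmap C x e \<in> carrier (Dmod C (x + cdeg C))"
  by (rule linear_mapsD(1)[OF i_linear] linear_mapsD(1)[OF j_linear] linear_mapsD(1)[OF k_linear];
      assumption)+

lemma j_i: "u \<in> carrier (Dmod C x) \<Longrightarrow> jmap C (x + adeg C) (imap C x u) = \<zero>\<^bsub>Emod C (x + adeg C + bdeg C)\<^esub>"
  using exact_ij[of "x + adeg C"] by (auto simp: a_kernel_def')

lemma j_zeroE:
  assumes "u \<in> carrier (Dmod C x)" "jmap C x u = \<zero>\<^bsub>Emod C (x + bdeg C)\<^esub>"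
  obtains w where "w \<in> carrier (Dmod C (x - adeg C))" "u = imap C (x - adeg C) w"
  using exact_ij[of x] assms by (auto simp: a_kernel_def')

lemma k_j: "u \<in> carrier (Dmod C x) \<Longrightarrow> kmap C (x + bdeg C) (jmap C x u) = \<zero>\<^bsub>Dmod C (x + bdeg C + cdeg C)\<^esub>"
  using exact_jk[of x] by (auto simp: a_kernel_def')

lemma i_k:
  assumes "e \<in> carrier (Emod C x)"
  shows "imap C (x + cdeg C) (kmap C x e) = \<zero>\<^bsub>Dmod C (x + cdeg C + adeg C)\<^esub>"
proof -
  have "x + adeg C + cdeg C = x + cdeg C + adeg C" by (simp add: algebra_simps)
  then show ?thesis using exact_ki[of "x - bdeg C"] assms by (auto simp: a_kernel_def' algebra_simps)
qed

lemma i_zeroE: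
  assumes "u \<in> carrier (Dmod C x)" "imap C x u = \<zero>\<^bsub>Dmod C (x + adeg C)\<^esub>"
  obtains e where "e \<in> carrier (Emod C (x - cdeg C))" "u = kmap C (x - cdeg C) e"
proof -
  have "x - bdeg C - cdeg C + adeg C + bdeg C + cdeg C = x + adeg C" by (simp add: algebra_simps)
  then show ?thesis
    using exact_ki[of "x - bdeg C - cdeg C"] assms that by (auto simp: a_kernel_def' algebra_simps)
qed

lemma Zsub_submodule: "submodule (Zsub C m x) R (Emod C x)"
proof -
  let ?S = "x + cdeg C - deg_times m (adeg C)"
  interpret E: left_module R "Emod C x" by (rule E_module)
  interpret D: left_module R "Dmod C ?S" by (rule D_module)
  interpret I: abelian_group_hom "Dmod C ?S" "Dmod C (x + cdeg C)" "ipow C m ?S"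
    using ipow_hom[of ?S m] by simp
  interpret K: abelian_group_hom "Emod C x" "Dmod C (x + cdeg C)" "kmap C x" by (rule k_hom)
  show ?thesis
  proof (rule E.submoduleI)
    show "Zsub C m x \<subseteq> carrier (Emod C x)" by (auto simp: Zsub_def)
    show "\<zero>\<^bsub>Emod C x\<^esub> \<in> Zsub C m x"
      by (auto simp: Zsub_def intro!: image_eqI[where x = "\<zero>\<^bsub>Dmod C ?S\<^esub>"])
  next
    fix e e' assume "e \<in> Zsub C m x" "e' \<in> Zsub C m x"
    then obtain u u' where "e \<in> carrier (Emod C x)" "e' \<in> carrier (Emod C x)"
      "u \<in> carrier (Dmod C ?S)" "u' \<in> carrier (Dmod C ?S)"
      "kmap C x e = ipow C m ?S u" "kmap C x e' = ipow C m ?S u'"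
      by (auto simp: Zsub_def)
    then show "e \<oplus>\<^bsub>Emod C x\<^esub> e' \<in> Zsub C m x"
      by (auto simp: Zsub_def intro!: image_eqI[where x = "u \<oplus>\<^bsub>Dmod C ?S\<^esub> u'"])
  next
    fix a e assume a: "a \<in> carrier R" and "e \<in> Zsub C m x"
    then obtain u where "e \<in> carrier (Emod C x)" "u \<in> carrier (Dmod C ?S)"
      "kmap C x e = ipow C m ?S u"
      by (auto simp: Zsub_def)
    then show "a \<odot>\<^bsub>Emod C x\<^esub> e \<in> Zsub C m x" using a
      by (auto simp: Zsub_def E.smult_closed D.smult_closed linear_mapsD(3)[OF k_linear]
          linear_mapsD(3)[OF ipow_linear] intro!: image_eqI[where x = "a \<odot>\<^bsub>Dmod C ?S\<^esub> u"])
  qed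
qed

lemma mem_BsubE:
  assumes "e \<in> Bsub C m x"
  obtains u where "u \<in> carrier (Dmod C (x - bdeg C))" "e = jmap C (x - bdeg C) u"
    "ipow C m (x - bdeg C) u = \<zero>\<^bsub>Dmod C (x - bdeg C + deg_times m (adeg C))\<^esub>"
  using assms by (auto simp: Bsub_def a_kernel_def')

lemma mem_BsubI:
  assumes "u \<in> carrier (Dmod C (x - bdeg C))" "e = jmap C (x - bdeg C) u"
    "ipow C m (x - bdeg C) u = \<zero>\<^bsub>Dmod C (x - bdeg C + deg_times m (adeg C))\<^esub>"
  shows "e \<in> Bsub C m x"
  using assms by (auto simp: Bsub_def a_kernel_def')

lemma Bsub_submodule: "submodule (Bsub C m x) R (Emod C x)"
proof -
  let ?S = "x - bdeg C"
  interpret E: left_module R "Emod C x" by (rule E_module)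
  interpret D: left_module R "Dmod C ?S" by (rule D_module)
  interpret T: left_module R "Dmod C (?S + deg_times m (adeg C))" by (rule D_module)
  interpret I: abelian_group_hom "Dmod C ?S" "Dmod C (?S + deg_times m (adeg C))" "ipow C m ?S"
    by (rule ipow_hom)
  interpret J: abelian_group_hom "Dmod C ?S" "Emod C x" "jmap C ?S"
    using j_hom[of ?S] by simp
  show ?thesis
  proof (rule E.submoduleI)
    show "Bsub C m x \<subseteq> carrier (Emod C x)" by (auto elim!: mem_BsubE)
    show "\<zero>\<^bsub>Emod C x\<^esub> \<in> Bsub C m x"
      by (rule mem_BsubI[where u = "\<zero>\<^bsub>Dmod C ?S\<^esub>"]) auto
  next
    fix e e' assume "e \<in> Bsub C m x" "e' \<in> Bsub C m x"
    then obtain u u' where "u \<in> carrier (Dmod C ?S)" "u' \<in> carrier (Dmod C ?S)"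
      "e = jmap C ?S u" "e' = jmap C ?S u'"
      "ipow C m ?S u = \<zero>\<^bsub>Dmod C (?S + deg_times m (adeg C))\<^esub>"
      "ipow C m ?S u' = \<zero>\<^bsub>Dmod C (?S + deg_times m (adeg C))\<^esub>"
      by (metis mem_BsubE)
    then show "e \<oplus>\<^bsub>Emod C x\<^esub> e' \<in> Bsub C m x"
      by (intro mem_BsubI[where u = "u \<oplus>\<^bsub>Dmod C ?S\<^esub> u'"]) auto
  next
    fix a e assume a: "a \<in> carrier R" and "e \<in> Bsub C m x"
    then obtain u where u: "u \<in> carrier (Dmod C ?S)" "e = jmap C ?S u"
      "ipow C m ?S u = \<zero>\<^bsub>Dmod C (?S + deg_times m (adeg C))\<^esub>"
      by (metis mem_BsubE)
    interpret A: abelian_group_hom "Dmod C (?S + deg_times m (adeg C))"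
      "Dmod C (?S + deg_times m (adeg C))" "\<lambda>v. a \<odot>\<^bsub>Dmod C (?S + deg_times m (adeg C))\<^esub> v"
      using a by (rule T.smult_group_hom)
    from u a A.hom_zero show "a \<odot>\<^bsub>Emod C x\<^esub> e \<in> Bsub C m x"
      using linear_mapsD(3)[OF j_linear a u(1)] linear_mapsD(3)[OF ipow_linear a u(1)]
      by (intro mem_BsubI[where u = "a \<odot>\<^bsub>Dmod C ?S\<^esub> u"]) (auto simp: D.smult_closed)
  qed
qed

lemma Z_carrier: "e \<in> Zsub C m x \<Longrightarrow> e \<in> carrier (Emod C x)"
  by (simp add: Zsub_def)

text \<open>Boundaries are of the form \<open>j u\<close>, and \<open>k j = 0\<close>.\<close>

lemma Bsub_subset_Zsub: "Bsub C m x \<subseteq> Zsub C n x"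
proof
  fix e assume "e \<in> Bsub C m x"
  then obtain u where u: "u \<in> carrier (Dmod C (x - bdeg C))" "e = jmap C (x - bdeg C) u"
    by (rule mem_BsubE)
  let ?S = "x + cdeg C - deg_times n (adeg C)"
  interpret I: abelian_group_hom "Dmod C ?S" "Dmod C (x + cdeg C)" "ipow C n ?S"
    using ipow_hom[of ?S n] by simp
  have "e \<in> carrier (Emod C x)" "kmap C x e = \<zero>\<^bsub>Dmod C (x + cdeg C)\<^esub>"
    using u j_closed[OF u(1)] k_j[OF u(1)] by auto
  then show "e \<in> Zsub C n x"
    by (auto simp: Zsub_def intro!: image_eqI[where x = "\<zero>\<^bsub>Dmod C ?S\<^esub>"])
qed

lemma Zsub_Suc_subset: "Zsub C (Suc m) x \<subseteq> Zsub C m x"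
proof
  let ?S = "x + cdeg C - deg_times (Suc m) (adeg C)"
  fix e assume "e \<in> Zsub C (Suc m) x"
  then obtain w where w: "w \<in> carrier (Dmod C ?S)" "e \<in> carrier (Emod C x)"
    "kmap C x e = ipow C (Suc m) ?S w" by (auto simp: Zsub_def simp del: ipow.simps)
  have S: "?S + adeg C = x + cdeg C - deg_times m (adeg C)" by (simp add: deg_times_Suc algebra_simps)
  show "e \<in> Zsub C m x"
    using w i_closed[OF w(1)] unfolding Zsub_def ipow_Suc_left S by auto
qed

lemma Bsub_Suc_superset: "Bsub C m x \<subseteq> Bsub C (Suc m) x"
proof
  fix e assume "e \<in> Bsub C m x"
  then obtain u where u: "u \<in> carrier (Dmod C (x - bdeg C))" "e = jmap C (x - bdeg C) u"
    "ipow C m (x - bdeg C) u = \<zero>\<^bsub>Dmod C (x - bdeg C + deg_times m (adeg C))\<^esub>"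
    by (rule mem_BsubE)
  interpret I: abelian_group_hom "Dmod C (x - bdeg C + deg_times m (adeg C))"
    "Dmod C (x - bdeg C + deg_times m (adeg C) + adeg C)" "imap C (x - bdeg C + deg_times m (adeg C))"
    by (rule i_hom)
  show "e \<in> Bsub C (Suc m) x"
    using u I.hom_zero by (intro mem_BsubI[of u]) (auto simp: deg_times_Suc add.assoc)
qed

lemma diff_rel_carrier:
  assumes "diff_rel C m x e e'"
  shows "e \<in> carrier (Emod C x)" "e' \<in> carrier (Emod C (x + diff_deg C (Suc m)))"
proof -
  let ?S = "x + cdeg C - deg_times m (adeg C)"
  have Sb: "?S + bdeg C = x + diff_deg C (Suc m)" by (simp add: diff_deg_Suc algebra_simps)
  obtain y where "y \<in> carrier (Dmod C ?S)" "e' = jmap C ?S y" using assms by (auto simp: diff_rel_def)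
  then show "e' \<in> carrier (Emod C (x + diff_deg C (Suc m)))"
    using j_closed[of y ?S] unfolding Sb by simp
  show "e \<in> carrier (Emod C x)" using assms by (simp add: diff_rel_def)
qed

lemma Zsub_iff_diff_rel: "e \<in> Zsub C m x \<longleftrightarrow> (\<exists>e'. diff_rel C m x e e')"
  unfolding Zsub_def diff_rel_def by (auto simp: image_iff) metis+

lemma diff_rel_minus:
  assumes "diff_rel C m x e e'" "diff_rel C m x w w'"
  shows "diff_rel C m x (e \<ominus>\<^bsub>Emod C x\<^esub> w) (e' \<ominus>\<^bsub>Emod C (x + diff_deg C (Suc m))\<^esub> w')"
proof -
  let ?S = "x + cdeg C - deg_times m (adeg C)"
  have Sb: "?S + bdeg C = x + diff_deg C (Suc m)" by (simp add: diff_deg_Suc algebra_simps)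
  interpret I: abelian_group_hom "Dmod C ?S" "Dmod C (x + cdeg C)" "ipow C m ?S"
    using ipow_hom[of ?S m] by simp
  interpret K: abelian_group_hom "Emod C x" "Dmod C (x + cdeg C)" "kmap C x" by (rule k_hom)
  interpret J: abelian_group_hom "Dmod C ?S" "Emod C (x + diff_deg C (Suc m))" "jmap C ?S"
    using j_hom[of ?S] unfolding Sb .
  obtain u v where "u \<in> carrier (Dmod C ?S)" "ipow C m ?S u = kmap C x e" "e' = jmap C ?S u"
    "v \<in> carrier (Dmod C ?S)" "ipow C m ?S v = kmap C x w" "w' = jmap C ?S v"
    using assms by (auto simp: diff_rel_def)
  then show ?thesis using assms unfolding diff_rel_def
    by (intro conjI bexI[where x = "u \<ominus>\<^bsub>Dmod C ?S\<^esub> v"])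
      (auto simp: I.hom_minus K.hom_minus J.hom_minus)
qed

lemma diff_rel_Zsub:
  assumes "diff_rel C m x e e'" shows "e' \<in> Zsub C n (x + diff_deg C (Suc m))"
proof -
  let ?S = "x + cdeg C - deg_times m (adeg C)" and ?x' = "x + diff_deg C (Suc m)"
  have Sb: "?S + bdeg C = ?x'" by (simp add: diff_deg_Suc algebra_simps)
  let ?T = "?x' + cdeg C - deg_times n (adeg C)"
  interpret I: abelian_group_hom "Dmod C ?T" "Dmod C (?x' + cdeg C)" "ipow C n ?T"
    using ipow_hom[of ?T n] by simp
  obtain u where "u \<in> carrier (Dmod C ?S)" "e' = jmap C ?S u"
    using assms by (auto simp: diff_rel_def)
  then have "kmap C ?x' e' = \<zero>\<^bsub>Dmod C (?x' + cdeg C)\<^esub>" using k_j unfolding Sb[symmetric] by auto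
  then show ?thesis using diff_rel_carrier(2)[OF assms]
    by (auto simp: Zsub_def intro!: image_eqI[where x = "\<zero>\<^bsub>Dmod C ?T\<^esub>"])
qed

text \<open>The kernel of \<open>d\<^sub>m\<^sub>+\<^sub>1\<close>. If \<open>i\<^sup>m y = k e\<close> and \<open>j y = j u\<close> with \<open>i\<^sup>m u = 0\<close>, then \<open>y - u\<close> is in
  the kernel of \<open>j\<close>, say \<open>y - u = i w\<close>, and \<open>i\<^sup>m\<^sup>+\<^sup>1 w = k e\<close>. The converse reads this backwards,
  with \<open>u = y - i w\<close>.\<close>

lemma diff_rel_Bsub_iff:
  assumes "diff_rel C m x e e'"
  shows "e' \<in> Bsub C m (x + diff_deg C (Suc m)) \<longleftrightarrow> e \<in> Zsub C (Suc m) x"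
proof -
  let ?S = "x + cdeg C - deg_times m (adeg C)" and ?x' = "x + diff_deg C (Suc m)"
  have Sb: "?S + bdeg C = ?x'" and Sb': "?x' - bdeg C = ?S"
    by (simp_all add: diff_deg_Suc algebra_simps)
  have Sa: "x + cdeg C - deg_times (Suc m) (adeg C) = ?S - adeg C"
    by (simp add: deg_times_Suc algebra_simps)
  interpret I: abelian_group_hom "Dmod C ?S" "Dmod C (x + cdeg C)" "ipow C m ?S"
    using ipow_hom[of ?S m] by simp
  interpret J: abelian_group_hom "Dmod C ?S" "Emod C ?x'" "jmap C ?S"
    using j_hom[of ?S] unfolding Sb .
  obtain y where y: "y \<in> carrier (Dmod C ?S)" "ipow C m ?S y = kmap C x e" "e' = jmap C ?S y"
    "e \<in> carrier (Emod C x)"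
    using assms by (auto simp: diff_rel_def)
  show ?thesis
  proof
    assume "e' \<in> Bsub C m ?x'"
    then obtain u where u: "u \<in> carrier (Dmod C ?S)" "e' = jmap C ?S u"
      "ipow C m ?S u = \<zero>\<^bsub>Dmod C (x + cdeg C)\<^esub>"
      by (rule mem_BsubE) (simp add: Sb')
    have "jmap C ?S (y \<ominus>\<^bsub>Dmod C ?S\<^esub> u) = \<zero>\<^bsub>Emod C ?x'\<^esub>"
      using y u by (simp add: J.hom_minus J.H.r_neg a_minus_def)
    then obtain w where w: "w \<in> carrier (Dmod C (?S - adeg C))"
      "y \<ominus>\<^bsub>Dmod C ?S\<^esub> u = imap C (?S - adeg C) w"
      using j_zeroE[of "y \<ominus>\<^bsub>Dmod C ?S\<^esub> u" ?S] y u unfolding Sb by auto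
    have "ipow C (Suc m) (?S - adeg C) w = ipow C m ?S (y \<ominus>\<^bsub>Dmod C ?S\<^esub> u)"
      using w by (simp add: ipow_Suc_left del: ipow.simps)
    also have "\<dots> = kmap C x e" using y u k_closed by (simp add: I.hom_minus a_minus_def)
    finally show "e \<in> Zsub C (Suc m) x"
      using w y unfolding Zsub_def Sa by (metis (mono_tags, lifting) imageI mem_Collect_eq)
  next
    assume "e \<in> Zsub C (Suc m) x"
    then obtain w where w: "w \<in> carrier (Dmod C (?S - adeg C))"
      "kmap C x e = ipow C (Suc m) (?S - adeg C) w"
      unfolding Zsub_def Sa by blast
    let ?v = "imap C (?S - adeg C) w"
    have v: "?v \<in> carrier (Dmod C ?S)" using i_closed[OF w(1)] by simp
    have "jmap C ?S ?v = \<zero>\<^bsub>Emod C ?x'\<^esub>" using j_i[OF w(1)] by (simp add: Sb)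
    then have "e' = jmap C ?S (y \<ominus>\<^bsub>Dmod C ?S\<^esub> ?v)"
      using y v by (simp add: J.hom_minus a_minus_def)
    moreover have "ipow C m ?S (y \<ominus>\<^bsub>Dmod C ?S\<^esub> ?v) = \<zero>\<^bsub>Dmod C (x + cdeg C)\<^esub>"
      using y v w k_closed[OF y(4)]
      by (simp add: I.hom_minus ipow_Suc_left a_minus_def I.H.r_neg del: ipow.simps)
    ultimately show "e' \<in> Bsub C m ?x'"
      using y v by (intro mem_BsubI[of "y \<ominus>\<^bsub>Dmod C ?S\<^esub> ?v"]) (simp_all add: Sb')
  qed
qed

text \<open>The image of \<open>d\<^sub>m\<^sub>+\<^sub>1\<close>: \<open>i\<^sup>m\<^sup>+\<^sup>1 u = 0\<close> means that \<open>i\<^sup>m u\<close> is in the kernel of \<open>i\<close>, that is, in the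
  image of \<open>k\<close>.\<close>

lemma Bsub_Suc_iff_diff_rel:
  "e' \<in> Bsub C (Suc m) x \<longleftrightarrow> (\<exists>e. diff_rel C m (x - diff_deg C (Suc m)) e e')"
proof -
  let ?x' = "x - diff_deg C (Suc m)"
  let ?S = "x - bdeg C"
  have S: "?x' + cdeg C - deg_times m (adeg C) = ?S"
    by (simp add: diff_deg_Suc algebra_simps)
  have x': "?S + deg_times m (adeg C) - cdeg C = ?x'" by (simp add: diff_deg_Suc algebra_simps)
  have Sc: "?S + deg_times m (adeg C) = ?x' + cdeg C" by (simp add: diff_deg_Suc algebra_simps)
  have Sa: "?S + deg_times (Suc m) (adeg C) = ?S + deg_times m (adeg C) + adeg C"
    by (simp add: deg_times_Suc)
  show ?thesis
  proof
    assume "e' \<in> Bsub C (Suc m) x"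
    then obtain u where u: "u \<in> carrier (Dmod C ?S)" "e' = jmap C ?S u"
      "imap C (?S + deg_times m (adeg C)) (ipow C m ?S u) =
         \<zero>\<^bsub>Dmod C (?S + deg_times m (adeg C) + adeg C)\<^esub>"
      by (rule mem_BsubE) (simp add: Sa)
    from i_zeroE[OF _ u(3)] obtain e where "e \<in> carrier (Emod C ?x')" "ipow C m ?S u = kmap C ?x' e"
      using linear_mapsD(1)[OF ipow_linear u(1)] unfolding x' by blast
    with u show "\<exists>e. diff_rel C m ?x' e e'" unfolding diff_rel_def S by metis
  next
    assume "\<exists>e. diff_rel C m ?x' e e'"
    then obtain e u where "e \<in> carrier (Emod C ?x')" "u \<in> carrier (Dmod C ?S)"
      "ipow C m ?S u = kmap C ?x' e" "e' = jmap C ?S u"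
      unfolding diff_rel_def S by blast
    then show "e' \<in> Bsub C (Suc m) x"
      using i_k[of e ?x'] by (intro mem_BsubI[of u]) (auto simp: Sa Sc)
  qed
qed

lemma Zsub_antimono: "m \<le> n \<Longrightarrow> Zsub C n x \<subseteq> Zsub C m x"
  by (rule lift_Suc_antimono_le[of "\<lambda>m. Zsub C m x"]) (rule Zsub_Suc_subset)

lemma Bsub_mono: "m \<le> n \<Longrightarrow> Bsub C m x \<subseteq> Bsub C n x"
  by (rule lift_Suc_mono_le[of "\<lambda>m. Bsub C m x"]) (rule Bsub_Suc_superset)

lemma page_Suc: "page C (Suc m) x = subquotient (Emod C x) (Zsub C m x) (Bsub C m x)"
  by (simp add: page_def)

lemma zero_page_iff: "zero_module (page C (Suc m) x) \<longleftrightarrow> Zsub C m x \<subseteq> Bsub C m x"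
  unfolding page_Suc
  by (intro zero_module_subquotient_iff E_group submodule_additive[OF Zsub_submodule]
      submodule_additive[OF Bsub_submodule] Bsub_subset_Zsub)

text \<open>A differential into a zero object leaves the cycles unchanged; by the next lemma, one out of a
  zero object leaves the boundaries unchanged.\<close>

lemma Zsub_stable:
  assumes "Zsub C m (x + diff_deg C (Suc m)) \<subseteq> Bsub C m (x + diff_deg C (Suc m))"
  shows "Zsub C (Suc m) x = Zsub C m x"
  using assms Zsub_Suc_subset Zsub_iff_diff_rel diff_rel_Zsub diff_rel_Bsub_iff by blast

lemma Bsub_stable:
  assumes "Zsub C m (x - diff_deg C (Suc m)) \<subseteq> Bsub C m (x - diff_deg C (Suc m))"
  shows "Bsub C (Suc m) x = Bsub C m x"
proof -
  have "e' \<in> Bsub C m x" if e': "e' \<in> Bsub C (Suc m) x" for e'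
  proof -
    from e' obtain e where e: "diff_rel C m (x - diff_deg C (Suc m)) e e'"
      using Bsub_Suc_iff_diff_rel by blast
    then have "e \<in> Bsub C m (x - diff_deg C (Suc m))" using assms Zsub_iff_diff_rel by blast
    then have "e \<in> Zsub C (Suc m) (x - diff_deg C (Suc m))" using Bsub_subset_Zsub by blast
    with diff_rel_Bsub_iff[OF e] show ?thesis by simp
  qed
  then show ?thesis using Bsub_Suc_superset by blast
qed

lemma page_class_eq_iff:
  assumes "e \<in> carrier (Emod C x)" "w \<in> carrier (Emod C x)"
  shows "page_class C (Suc m) x e = page_class C (Suc m) x w \<longleftrightarrow> e \<ominus>\<^bsub>Emod C x\<^esub> w \<in> Bsub C m x"
  unfolding page_class_def
  using assms abelian_subgroup.coset_eq_iff[OF submodule_abelian_subgroup[OF Bsub_submodule E_group]]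
  by simp

lemma diff_page_class:
  assumes z: "diff_rel C m x z z'"
  shows "diff C (Suc m) x (page_class C (Suc m) x z) =
    page_class C (Suc m) (x + diff_deg C (Suc m)) z'"
proof -
  let ?x' = "x + diff_deg C (Suc m)" and ?S = "x + cdeg C - deg_times m (adeg C)"
  interpret B: abelian_subgroup "Bsub C m x" "Emod C x"
    by (rule submodule_abelian_subgroup[OF Bsub_submodule E_group])
  have zc: "z \<in> carrier (Emod C x)" "z' \<in> carrier (Emod C ?x')" using diff_rel_carrier[OF z] by auto
  \<comment> \<open>All members of the union that defines \<open>diff\<close> are equal.\<close>
  have eq: "page_class C (Suc m) ?x' e' = page_class C (Suc m) ?x' z'"
    if e: "e \<in> page_class C (Suc m) x z" "diff_rel C m x e e'" for e e'
  proof -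
    have ec: "e \<in> carrier (Emod C x)" "e' \<in> carrier (Emod C ?x')" using diff_rel_carrier[OF e(2)] by auto
    have "e \<ominus>\<^bsub>Emod C x\<^esub> z \<in> Bsub C m x"
      using e(1) ec zc by (simp add: page_class_def B.a_rcos_module a_minus_def)
    then have "e \<ominus>\<^bsub>Emod C x\<^esub> z \<in> Zsub C (Suc m) x" using Bsub_subset_Zsub by blast
    then show ?thesis
      using diff_rel_Bsub_iff[OF diff_rel_minus[OF e(2) z]] ec zc by (simp add: page_class_eq_iff)
  qed
  have self: "z \<in> page_class C (Suc m) x z" using zc by (simp add: page_class_def B.a_rcos_self)
  have car: "e \<in> carrier (Emod C x)" if "e \<in> page_class C (Suc m) x z" for e
    using that zc B.a_elemrcos_carrier unfolding page_class_def by auto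
  have "diff C (Suc m) x (page_class C (Suc m) x z) =
      \<Union>{page_class C (Suc m) ?x' e' | e' e. e \<in> page_class C (Suc m) x z \<and> diff_rel C m x e e'}"
    unfolding diff_def diff_rel_def diff_Suc_1 using car by (intro arg_cong[where f = Union]) blast
  also have "{page_class C (Suc m) ?x' e' | e' e. e \<in> page_class C (Suc m) x z \<and> diff_rel C m x e e'} =
      {page_class C (Suc m) ?x' z'}"
    using eq self z by blast
  finally show ?thesis by simp
qed

end

section \<open>Comparing the pages of two exact couples\<close>

context exact_couple_morphism begin

lemma diff_deg_eq: "diff_deg C1 r = diff_deg C2 r"
  by (simp add: diff_deg_def degrees)

lemma f_closed: "u \<in> carrier (Dmod C1 x) \<Longrightarrow> f x u \<in> carrier (Dmod C2 x)"
  and g_closed: "e \<in> carrier (Emod C1 x) \<Longrightarrow> g x e \<in> carrier (Emod C2 x)"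
  by (rule linear_mapsD(1)[OF f_linear] linear_mapsD(1)[OF g_linear]; assumption)+

lemma f_hom: "abelian_group_hom (Dmod C1 x) (Dmod C2 x) (f x)"
  and g_hom: "abelian_group_hom (Emod C1 x) (Emod C2 x) (g x)"
  by (rule linear_maps_group_hom[OF C1.D_group C2.D_group f_linear]
      linear_maps_group_hom[OF C1.E_group C2.E_group g_linear])+

lemma f_ipow:
  assumes u: "u \<in> carrier (Dmod C1 x)"
  shows "f (x + deg_times m (adeg C1)) (ipow C1 m x u) = ipow C2 m x (f x u)"
proof (induction m)
  case 0 show ?case by simp
next
  case (Suc m)
  from commute_i[OF linear_mapsD(1)[OF C1.ipow_linear u, of m]] Suc show ?case
    by (simp add: deg_times_Suc add.assoc degrees)
qed

lemma g_diff_rel: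
  assumes "diff_rel C1 m x e e'"
  shows "diff_rel C2 m x (g x e) (g (x + diff_deg C1 (Suc m)) e')"
proof -
  let ?S = "x + cdeg C1 - deg_times m (adeg C1)"
  have Sb: "?S + bdeg C1 = x + diff_deg C1 (Suc m)" by (simp add: diff_deg_Suc algebra_simps)
  obtain y where y: "e \<in> carrier (Emod C1 x)" "y \<in> carrier (Dmod C1 ?S)"
    "ipow C1 m ?S y = kmap C1 x e" "e' = jmap C1 ?S y"
    using assms by (auto simp: diff_rel_def)
  have "ipow C2 m ?S (f ?S y) = kmap C2 x (g x e)"
    using f_ipow[OF y(2), of m] commute_k[OF y(1)] y(3) by simp
  moreover have "g (x + diff_deg C1 (Suc m)) e' = jmap C2 ?S (f ?S y)"
    using commute_j[OF y(2)] y(4) unfolding Sb by simp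
  ultimately show ?thesis
    using g_closed[OF y(1)] f_closed[OF y(2)] unfolding diff_rel_def degrees[symmetric] by blast
qed

lemma g_Zsub: "e \<in> Zsub C1 m x \<Longrightarrow> g x e \<in> Zsub C2 m x"
  using C1.Zsub_iff_diff_rel C2.Zsub_iff_diff_rel g_diff_rel by blast

lemma g_Bsub:
  assumes "e \<in> Bsub C1 m x" shows "g x e \<in> Bsub C2 m x"
proof -
  have ad: "adeg C2 = adeg C1" "bdeg C2 = bdeg C1" using degrees by simp_all
  obtain u where u: "u \<in> carrier (Dmod C1 (x - bdeg C1))" "e = jmap C1 (x - bdeg C1) u"
    "ipow C1 m (x - bdeg C1) u = \<zero>\<^bsub>Dmod C1 (x - bdeg C1 + deg_times m (adeg C1))\<^esub>"
    using assms by (rule C1.mem_BsubE)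
  have "g x e = jmap C2 (x - bdeg C1) (f (x - bdeg C1) u)" using commute_j[OF u(1)] u(2) by simp
  moreover have "ipow C2 m (x - bdeg C1) (f (x - bdeg C1) u) =
      \<zero>\<^bsub>Dmod C2 (x - bdeg C1 + deg_times m (adeg C1))\<^esub>"
    using f_ipow[OF u(1), of m] u(3) abelian_group_hom.hom_zero[OF f_hom] by simp
  ultimately show ?thesis
    using f_closed[OF u(1)] by (intro C2.mem_BsubI[of "f (x - bdeg C1) u"]) (simp_all add: ad)
qed

lemma page_hom:
  "subquotient_hom R (Emod C1 x) (Emod C2 x) (Zsub C1 m x) (Bsub C1 m x)
     (Zsub C2 m x) (Bsub C2 m x) (g x)"
  by (intro subquotient_hom.intro subquotient_hom_axioms.intro C1.E_module C2.E_module
      g_linear C1.Zsub_submodule C2.Zsub_submodule C1.Bsub_submodule C2.Bsub_submodule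
      C1.Bsub_subset_Zsub C2.Bsub_subset_Zsub) (auto intro: g_Zsub g_Bsub)

text \<open>Surjectivity and injectivity of \<open>f\<^sub>m\<^sub>+\<^sub>1\<close> at one position.\<close>

definition page_surj :: "nat \<Rightarrow> int \<times> int \<Rightarrow> bool" where
  "page_surj m x \<longleftrightarrow> surj_mod (Emod C2 x) (Zsub C1 m x) (Zsub C2 m x) (Bsub C2 m x) (g x)"

definition page_inj :: "nat \<Rightarrow> int \<times> int \<Rightarrow> bool" where
  "page_inj m x \<longleftrightarrow> inj_mod (Zsub C1 m x) (Bsub C1 m x) (Bsub C2 m x) (g x)"

lemma page_surjD:
  assumes "page_surj m x" "e \<in> Zsub C2 m x"
  obtains w where "w \<in> Zsub C1 m x" "e \<ominus>\<^bsub>Emod C2 x\<^esub> g x w \<in> Bsub C2 m x"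
  using assms by (auto simp: page_surj_def surj_mod_def)

lemma page_injD: "page_inj m x \<Longrightarrow> e \<in> Zsub C1 m x \<Longrightarrow> g x e \<in> Bsub C2 m x \<Longrightarrow> e \<in> Bsub C1 m x"
  by (auto simp: page_inj_def inj_mod_def)

lemma page_iso_iff:
  "linear_iso R (page C1 (Suc m) x) (page C2 (Suc m) x) (page_map C2 g (Suc m) x)
     \<longleftrightarrow> page_surj m x \<and> page_inj m x"
  unfolding C1.page_Suc C2.page_Suc page_map_def page_surj_def page_inj_def diff_Suc_1
  by (rule subquotient_hom.linear_iso_iff[OF page_hom])

lemma page_surj_image:
  "page_surj m x \<longleftrightarrow> page_map C2 g (Suc m) x ` carrier (page C1 (Suc m) x) = carrier (page C2 (Suc m) x)"
  unfolding C1.page_Suc C2.page_Suc page_map_def page_surj_def diff_Suc_1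
  by (rule subquotient_hom.surj_iff[OF page_hom, symmetric])

text \<open>Lift a cycle \<open>e\<close> to some \<open>w\<close>. The differential of \<open>w\<close> becomes
  zero in the second couple, hence is zero, so the lift is a cycle too. The lift is correct modulo
  \<open>B\<^sub>m\<close>, which is more than surjectivity on the next page asks for; \<open>page_surj_descend\<close> needs it in
  this form.\<close>

lemma cycle_lift:
  assumes surj: "page_surj m x" and inj: "page_inj m (x + diff_deg C1 (Suc m))"
    and e: "e \<in> Zsub C2 (Suc m) x"
  obtains w where "w \<in> Zsub C1 (Suc m) x" "e \<ominus>\<^bsub>Emod C2 x\<^esub> g x w \<in> Bsub C2 m x"
proof -
  have "e \<in> Zsub C2 m x" using e C2.Zsub_Suc_subset by blast
  with surj obtain w where w: "w \<in> Zsub C1 m x" "e \<ominus>\<^bsub>Emod C2 x\<^esub> g x w \<in> Bsub C2 m x"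
    by (rule page_surjD)
  from w(1) obtain w' where w': "diff_rel C1 m x w w'" using C1.Zsub_iff_diff_rel by blast
  have "g x w \<in> Zsub C2 (Suc m) x"
    using submodule_cong[OF C2.Zsub_submodule C2.E_group, of e x "g x w"] e w
      C2.Z_carrier[OF e] g_closed[OF C1.Z_carrier[OF w(1)]] C2.Bsub_subset_Zsub by blast
  then have "g (x + diff_deg C1 (Suc m)) w' \<in> Bsub C2 m (x + diff_deg C1 (Suc m))"
    using C2.diff_rel_Bsub_iff[OF g_diff_rel[OF w'], folded diff_deg_eq] by blast
  then have "w' \<in> Bsub C1 m (x + diff_deg C1 (Suc m))"
    using page_injD[OF inj C1.diff_rel_Zsub[OF w']] by blast
  then have "w \<in> Zsub C1 (Suc m) x" using C1.diff_rel_Bsub_iff[OF w'] by blast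
  with w(2) that show ?thesis by blast
qed

lemma page_surj_Suc:
  assumes "page_surj m x" "page_inj m (x + diff_deg C1 (Suc m))"
  shows "page_surj (Suc m) x"
  unfolding page_surj_def surj_mod_def
proof
  fix e assume "e \<in> Zsub C2 (Suc m) x"
  with assms obtain w where "w \<in> Zsub C1 (Suc m) x" "e \<ominus>\<^bsub>Emod C2 x\<^esub> g x w \<in> Bsub C2 m x"
    by (rule cycle_lift)
  then show "\<exists>z\<in>Zsub C1 (Suc m) x. e \<ominus>\<^bsub>Emod C2 x\<^esub> g x z \<in> Bsub C2 (Suc m) x"
    using C2.Bsub_Suc_superset by blast
qed

text \<open>If \<open>g e\<close> is the differential of \<open>w\<close>, then surjectivity at the source replaces \<open>w\<close> by some \<open>g v\<close>,
  and injectivity at the target shows that \<open>e\<close> agrees with the differential of \<open>v\<close> modulo \<open>B\<^sub>m\<close>.\<close>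

lemma page_inj_Suc:
  assumes inj: "page_inj m x" and surj: "page_surj m (x - diff_deg C1 (Suc m))"
  shows "page_inj (Suc m) x"
  unfolding page_inj_def inj_mod_def
proof (intro ballI impI)
  let ?x' = "x - diff_deg C1 (Suc m)"
  have x': "?x' + diff_deg C1 (Suc m) = x" by simp
  fix e assume e: "e \<in> Zsub C1 (Suc m) x" and "g x e \<in> Bsub C2 (Suc m) x"
  then obtain w where w: "diff_rel C2 m ?x' w (g x e)"
    using C2.Bsub_Suc_iff_diff_rel diff_deg_eq by metis
  then have "w \<in> Zsub C2 m ?x'" using C2.Zsub_iff_diff_rel by blast
  with surj obtain v where v: "v \<in> Zsub C1 m ?x'" "w \<ominus>\<^bsub>Emod C2 ?x'\<^esub> g ?x' v \<in> Bsub C2 m ?x'"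
    by (rule page_surjD)
  from v(1) obtain v' where v': "diff_rel C1 m ?x' v v'" using C1.Zsub_iff_diff_rel by blast
  have ec: "e \<in> carrier (Emod C1 x)" using C1.Z_carrier[OF e] .
  have v'c: "v' \<in> carrier (Emod C1 x)" using C1.diff_rel_carrier(2)[OF v'] by simp
  have "diff_rel C2 m ?x' (w \<ominus>\<^bsub>Emod C2 ?x'\<^esub> g ?x' v) (g x e \<ominus>\<^bsub>Emod C2 x\<^esub> g x v')"
    using C2.diff_rel_minus[OF w g_diff_rel[OF v', unfolded x'], folded diff_deg_eq, unfolded x'] .
  moreover have "w \<ominus>\<^bsub>Emod C2 ?x'\<^esub> g ?x' v \<in> Zsub C2 (Suc m) ?x'"
    using v(2) C2.Bsub_subset_Zsub by blast
  ultimately have "g x e \<ominus>\<^bsub>Emod C2 x\<^esub> g x v' \<in> Bsub C2 m x"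
    using C2.diff_rel_Bsub_iff[folded diff_deg_eq] x' by metis
  then have "g x (e \<ominus>\<^bsub>Emod C1 x\<^esub> v') \<in> Bsub C2 m x"
    using abelian_group_hom.hom_minus[OF g_hom ec v'c] by simp
  moreover have "e \<ominus>\<^bsub>Emod C1 x\<^esub> v' \<in> Zsub C1 m x"
    using submodule_minus_closed[OF C1.Zsub_submodule] e C1.Zsub_Suc_subset C1.diff_rel_Zsub[OF v', of m]
    unfolding x' by blast
  ultimately have "e \<ominus>\<^bsub>Emod C1 x\<^esub> v' \<in> Bsub C1 (Suc m) x"
    using page_injD[OF inj] C1.Bsub_Suc_superset by blast
  moreover have "v' \<in> Bsub C1 (Suc m) x" using v' C1.Bsub_Suc_iff_diff_rel by blast
  ultimately show "e \<in> Bsub C1 (Suc m) x"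
    using submodule_cong[OF C1.Bsub_submodule C1.E_group ec v'c] by blast
qed

text \<open>Going back one page, where nothing enters the position (\<open>B\<^sub>m\<^sub>+\<^sub>1 = B\<^sub>m\<close>): an element of the kernel
  of \<open>f\<^sub>m\<^sub>+\<^sub>1\<close> is a cycle by injectivity at the target of the differential, so it is seen by the next
  page.\<close>

lemma page_inj_descend:
  assumes inj: "page_inj (Suc m) x" and inj': "page_inj m (x + diff_deg C1 (Suc m))"
    and B: "Bsub C1 (Suc m) x = Bsub C1 m x"
  shows "page_inj m x"
  unfolding page_inj_def inj_mod_def
proof (intro ballI impI)
  fix e assume e: "e \<in> Zsub C1 m x" and ge: "g x e \<in> Bsub C2 m x"
  from e obtain e' where e': "diff_rel C1 m x e e'" using C1.Zsub_iff_diff_rel by blast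
  have "g x e \<in> Zsub C2 (Suc m) x" using ge C2.Bsub_subset_Zsub by blast
  then have "g (x + diff_deg C1 (Suc m)) e' \<in> Bsub C2 m (x + diff_deg C1 (Suc m))"
    using C2.diff_rel_Bsub_iff[OF g_diff_rel[OF e'], folded diff_deg_eq] by blast
  then have "e' \<in> Bsub C1 m (x + diff_deg C1 (Suc m))"
    using page_injD[OF inj' C1.diff_rel_Zsub[OF e']] by blast
  then have "e \<in> Zsub C1 (Suc m) x" using C1.diff_rel_Bsub_iff[OF e'] by blast
  then show "e \<in> Bsub C1 m x"
    using page_injD[OF inj] ge C2.Bsub_Suc_superset B by blast
qed

text \<open>The surjective half of the four lemma described at the top. The class of the differential \<open>e'\<close> of
  \<open>e\<close> is lifted to a cycle \<open>w'\<close>. This \<open>w'\<close> dies on the next page of the second couple, hence also of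
  the first one, so it is the differential of some \<open>w\<close>. Now \<open>e - g w\<close> is a cycle, and the next page
  lifts it. Injectivity at the target of the target is what makes \<open>w'\<close> a cycle.\<close>

lemma page_surj_descend:
  assumes surj: "page_surj (Suc m) x"
    and surj': "page_surj m (x + diff_deg C1 (Suc m))"
    and inj': "page_inj (Suc m) (x + diff_deg C1 (Suc m))"
    and inj'': "page_inj m (x + diff_deg C1 (Suc m) + diff_deg C1 (Suc m))"
    and B: "Bsub C2 (Suc m) x = Bsub C2 m x"
  shows "page_surj m x"
  unfolding page_surj_def surj_mod_def
proof
  let ?x' = "x + diff_deg C1 (Suc m)"
  fix e assume e: "e \<in> Zsub C2 m x"
  then obtain e' where e': "diff_rel C2 m x e e'" using C2.Zsub_iff_diff_rel by blast
  have e'c: "e' \<in> carrier (Emod C2 ?x')" using C2.diff_rel_carrier(2)[OF e'] diff_deg_eq by simp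
  have "e' \<in> Zsub C2 (Suc m) ?x'" using C2.diff_rel_Zsub[OF e'] diff_deg_eq by simp
  then obtain w' where w': "w' \<in> Zsub C1 (Suc m) ?x'"
      "e' \<ominus>\<^bsub>Emod C2 ?x'\<^esub> g ?x' w' \<in> Bsub C2 m ?x'"
    by (rule cycle_lift[OF surj' inj''])
  have "e' \<in> Bsub C2 (Suc m) ?x'"
    using e' C2.Bsub_Suc_iff_diff_rel[of e' m ?x'] diff_deg_eq by (metis add_diff_cancel_right')
  then have "g ?x' w' \<in> Bsub C2 (Suc m) ?x'"
    using submodule_cong[OF C2.Bsub_submodule C2.E_group e'c, of "g ?x' w'"] w'(2)
      g_closed[OF C1.Z_carrier[OF w'(1)]] C2.Bsub_Suc_superset by blast
  then have "w' \<in> Bsub C1 (Suc m) ?x'" using page_injD[OF inj' w'(1)] by blast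
  then obtain w where w: "diff_rel C1 m x w w'"
    using C1.Bsub_Suc_iff_diff_rel[of w' m ?x'] by auto
  have c: "e \<in> carrier (Emod C2 x)" "g x w \<in> carrier (Emod C2 x)"
    using C2.Z_carrier[OF e] g_closed[OF C1.diff_rel_carrier(1)[OF w]] by auto
  have "diff_rel C2 m x (e \<ominus>\<^bsub>Emod C2 x\<^esub> g x w) (e' \<ominus>\<^bsub>Emod C2 ?x'\<^esub> g ?x' w')"
    using C2.diff_rel_minus[OF e' g_diff_rel[OF w], folded diff_deg_eq] .
  then have "e \<ominus>\<^bsub>Emod C2 x\<^esub> g x w \<in> Zsub C2 (Suc m) x"
    using C2.diff_rel_Bsub_iff[folded diff_deg_eq] w'(2) by blast
  with surj obtain v where v: "v \<in> Zsub C1 (Suc m) x"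
    "(e \<ominus>\<^bsub>Emod C2 x\<^esub> g x w) \<ominus>\<^bsub>Emod C2 x\<^esub> g x v \<in> Bsub C2 (Suc m) x"
    by (rule page_surjD)
  have vw: "w \<in> Zsub C1 m x" "v \<in> Zsub C1 m x"
    using w v(1) C1.Zsub_iff_diff_rel C1.Zsub_Suc_subset by blast+
  have "w \<oplus>\<^bsub>Emod C1 x\<^esub> v \<in> Zsub C1 m x"
    using vw additive_subgroup.a_closed[OF submodule_additive[OF C1.Zsub_submodule]] by blast
  moreover have "e \<ominus>\<^bsub>Emod C2 x\<^esub> g x (w \<oplus>\<^bsub>Emod C1 x\<^esub> v) =
      (e \<ominus>\<^bsub>Emod C2 x\<^esub> g x w) \<ominus>\<^bsub>Emod C2 x\<^esub> g x v"
    using abelian_group_minus_add[OF C2.E_group c g_closed] vw C1.Z_carrier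
      linear_mapsD(2)[OF g_linear] by simp
  ultimately show "\<exists>z\<in>Zsub C1 m x. e \<ominus>\<^bsub>Emod C2 x\<^esub> g x z \<in> Bsub C2 m x"
    using v(2) B by metis
qed

lemma page_map_class:
  "z \<in> carrier (Emod C1 x) \<Longrightarrow>
     page_map C2 g (Suc m) x (page_class C1 (Suc m) x z) = page_class C2 (Suc m) x (g x z)"
  unfolding page_map_def page_class_def diff_Suc_1
  by (rule subquotient_hom.coset_map_eq[OF page_hom])

lemma page_map_morphism:
  assumes "r0 \<ge> 1"
  shows "spectral_sequence_morphism R C1 C2 r0 (page_map C2 g)"
  unfolding spectral_sequence_morphism_def
proof (intro allI impI conjI ballI)
  fix r x assume "r \<ge> r0"
  then obtain m where r: "r = Suc m" using assms by (cases r) auto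
  show "diff_deg C1 r = diff_deg C2 r" by (rule diff_deg_eq)
  show "page_map C2 g r x \<in> linear_maps R (page C1 r x) (page C2 r x)"
    unfolding r page_map_def C1.page_Suc C2.page_Suc diff_Suc_1
    by (rule subquotient_hom.coset_map_linear[OF page_hom])
  {
    fix X assume "X \<in> carrier (page C1 r x)"
    then obtain z where z: "z \<in> Zsub C1 m x" "X = page_class C1 (Suc m) x z"
      by (auto simp: r C1.page_Suc subquotient_def page_class_def)
    from z(1) obtain z' where z': "diff_rel C1 m x z z'" using C1.Zsub_iff_diff_rel by blast
    show "page_map C2 g r (x + diff_deg C1 r) (diff C1 r x X) = diff C2 r x (page_map C2 g r x X)"
      using C1.diff_rel_carrier[OF z'] C1.diff_page_class[OF z'] C2.diff_page_class[OF g_diff_rel[OF z']]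
      by (simp add: r z(2) page_map_class diff_deg_eq)
  }
  {
    fix z w assume zw: "z \<in> Zsub C1 r x" "w \<in> Zsub C2 r x"
      and eq: "page_map C2 g r x (page_class C1 r x z) = page_class C2 r x w"
    have c: "z \<in> carrier (Emod C1 x)" "g x z \<in> carrier (Emod C2 x)" "w \<in> carrier (Emod C2 x)"
      using C1.Z_carrier[OF zw(1)] C2.Z_carrier[OF zw(2)] g_closed by auto
    have "g x z \<ominus>\<^bsub>Emod C2 x\<^esub> w \<in> Bsub C2 r x"
      using eq c subsetD[OF C2.Bsub_Suc_superset] unfolding r
      by (simp add: page_map_class C2.page_class_eq_iff)
    then show "page_map C2 g (Suc r) x (page_class C1 (Suc r) x z) = page_class C2 (Suc r) x w"
      using c by (simp add: page_map_class C2.page_class_eq_iff)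
  }
qed

end

section \<open>First-quadrant spectral sequences\<close>

locale first_quadrant_couple = exact_couple +
  assumes bidegree: "r \<ge> 2 \<Longrightarrow> diff_deg C r = (int r, - int r + 1)"
    and quadrant: "r \<ge> 2 \<Longrightarrow> p < 0 \<or> q < 0 \<Longrightarrow> zero_module (page C r (p, q))"
begin

lemma diff_deg_quadrant: "m \<ge> 1 \<Longrightarrow> diff_deg C (Suc m) = (int m + 1, - int m)"
  using bidegree[of "Suc m"] by simp

lemma page_zero_outside:
  assumes "m \<ge> 1" "p < 0 \<or> q < 0" shows "Zsub C m (p, q) = Bsub C m (p, q)"
proof
  show "Zsub C m (p, q) \<subseteq> Bsub C m (p, q)"
    using quadrant[of "Suc m" p q] assms unfolding zero_page_iff by linarith
qed (rule Bsub_subset_Zsub)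

lemma Zsub_stable_row:
  assumes "m \<ge> 1" "q < int m" shows "Zsub C (Suc m) (p, q) = Zsub C m (p, q)"
proof (rule Zsub_stable)
  have "(p, q) + diff_deg C (Suc m) = (p + int m + 1, q - int m)"
    using diff_deg_quadrant[OF assms(1)] by simp
  then show "Zsub C m ((p, q) + diff_deg C (Suc m)) \<subseteq> Bsub C m ((p, q) + diff_deg C (Suc m))"
    using page_zero_outside[OF assms(1), of "p + int m + 1" "q - int m"] assms(2) by simp
qed

lemma Bsub_stable_column:
  assumes "m \<ge> 1" "p \<le> int m" shows "Bsub C (Suc m) (p, q) = Bsub C m (p, q)"
proof (rule Bsub_stable)
  have "(p, q) - diff_deg C (Suc m) = (p - (int m + 1), q + int m)"
    using diff_deg_quadrant[OF assms(1)] by simp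
  then show "Zsub C m ((p, q) - diff_deg C (Suc m)) \<subseteq> Bsub C m ((p, q) - diff_deg C (Suc m))"
    using page_zero_outside[OF assms(1), of "p - (int m + 1)" "q + int m"] assms(2) by simp
qed

text \<open>At a fixed position only finitely many differentials start or end in the first quadrant, so
  the cycles and boundaries become constant and \<open>E\<^sub>\<infinity>\<close> is a page.\<close>

lemma Zinf_eq:
  assumes "m \<ge> 1" "q < int m" shows "(\<Inter>r. Zsub C r (p, q)) = Zsub C m (p, q)"
proof -
  have "Zsub C (m + k) (p, q) = Zsub C m (p, q)" for k
  proof (induction k)
    case (Suc k)
    then show ?case using Zsub_stable_row[of "m + k" q p] assms by simp
  qed simp
  note eq = this
  have "Zsub C m (p, q) \<subseteq> Zsub C r (p, q)" for r
    using Zsub_antimono[of r m "(p, q)"] eq[of "r - m"] by (cases "r \<le> m") simp_all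
  then show ?thesis by blast
qed

lemma Binf_eq:
  assumes "m \<ge> 1" "p \<le> int m" shows "Binf C (p, q) = Bsub C m (p, q)"
proof -
  have "Bsub C (m + k) (p, q) = Bsub C m (p, q)" for k
  proof (induction k)
    case (Suc k)
    then show ?case using Bsub_stable_column[of "m + k" p q] assms by simp
  qed simp
  note eq = this
  have "Bsub C r (p, q) \<subseteq> Bsub C m (p, q)" for r
    using Bsub_mono[of r m "(p, q)"] eq[of "r - m"] by (cases "r \<le> m") simp_all
  then show ?thesis by (auto simp: Binf_def)
qed

end

locale first_quadrant_morphism = exact_couple_morphism R C1 C2 f g +
  C1: first_quadrant_couple R C1 + C2: first_quadrant_couple R C2
  for R :: "('r, 'x) ring_scheme"
    and C1 :: "('r, 'd1, 'e1) couple" and C2 :: "('r, 'd2, 'e2) couple" and f g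
begin

lemma page_iso_outside:
  assumes "m \<ge> 1" "p < 0 \<or> q < 0"
  shows "page_surj m (p, q)" "page_inj m (p, q)"
proof -
  interpret g: abelian_group_hom "Emod C1 (p,q)" "Emod C2 (p,q)" "g (p,q)" by (rule g_hom)
  show "page_surj m (p, q)" unfolding page_surj_def surj_mod_def
  proof
    fix z assume z: "z \<in> Zsub C2 m (p, q)"
    have "\<zero>\<^bsub>Emod C1 (p,q)\<^esub> \<in> Zsub C1 m (p, q)"
      using additive_subgroup.zero_closed[OF submodule_additive[OF C1.Zsub_submodule]] .
    moreover have "z \<ominus>\<^bsub>Emod C2 (p,q)\<^esub> g (p,q) \<zero>\<^bsub>Emod C1 (p,q)\<^esub> \<in> Bsub C2 m (p, q)"
      using submodule_minus_closed[OF C2.Zsub_submodule z additive_subgroup.zero_closed[OF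
            submodule_additive[OF C2.Zsub_submodule]]] C2.page_zero_outside[OF assms] by simp
    ultimately show "\<exists>w\<in>Zsub C1 m (p, q). z \<ominus>\<^bsub>Emod C2 (p,q)\<^esub> g (p,q) w \<in> Bsub C2 m (p, q)" by blast
  qed
  show "page_inj m (p, q)" unfolding page_inj_def inj_mod_def
    using C1.page_zero_outside[OF assms] by blast
qed

text \<open>The differential of page \<open>m + 1\<close> goes down \<open>m\<close> rows, so from rows \<open>\<le> n\<close> it lands where
  injectivity holds, and this suffices for surjectivity on the next page.
  Injectivity on page \<open>m + 2\<close> also looks at the source of the differential, \<open>m\<close> rows higher: it has
  to lie in a row \<open>\<le> n\<close>, whence the bound \<open>q + m \<le> n + 1\<close>.\<close>

lemma page_rows:
  assumes iso: "\<And>p q. q \<le> n \<Longrightarrow> page_surj 1 (p, q) \<and> page_inj 1 (p, q)" and m: "m \<ge> 1"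
  shows "q \<le> n \<Longrightarrow> page_surj m (p, q)" and "q + int m \<le> n + 1 \<Longrightarrow> page_inj m (p, q)"
proof -
  have "\<forall>p q. (q \<le> n \<longrightarrow> page_surj m (p, q)) \<and> (q + int m \<le> n + 1 \<longrightarrow> page_inj m (p, q))"
    using m
  proof (induction m rule: nat_induct_at_least)
    case base then show ?case using iso by auto
  next
    case (Suc m)
    have surj: "q \<le> n \<Longrightarrow> page_surj m (p, q)" and inj: "q + int m \<le> n + 1 \<Longrightarrow> page_inj m (p, q)" for p q
      using Suc.IH by auto
    show ?case
    proof (intro allI conjI impI)
      fix p q assume "q \<le> n"
      then show "page_surj (Suc m) (p, q)"
        using Suc.hyps by (intro page_surj_Suc) (simp_all add: C1.diff_deg_quadrant surj inj)
    next
      fix p q assume "q + int (Suc m) \<le> n + 1"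
      then show "page_inj (Suc m) (p, q)"
        using Suc.hyps by (intro page_inj_Suc) (simp_all add: C1.diff_deg_quadrant surj inj)
    qed
  qed
  then show "q \<le> n \<Longrightarrow> page_surj m (p, q)" and "q + int m \<le> n + 1 \<Longrightarrow> page_inj m (p, q)" by auto
qed

end

section \<open>The limit abutment\<close>

context first_quadrant_couple begin

text \<open>The bidegree of \<open>d\<^sub>r\<close> depends on \<open>r\<close> through \<open>- (r - 1) a\<close>, so any two of them determine \<open>a\<close>.\<close>

lemma adeg_eq: "adeg C = (-1, 1)"
  using diff_deg_quadrant[of 1, unfolded diff_deg_Suc] diff_deg_quadrant[of 2, unfolded diff_deg_Suc]
  by (auto simp: deg_times_def prod_eq_iff)

lemma page_inf_eq:
  assumes "m \<ge> 1" "p \<le> int m" "q < int m"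
  shows "page_inf C (p, q) = page C (Suc m) (p, q)"
  unfolding page_inf_def page_Suc Zinf_eq[OF assms(1,3)] Binf_eq[OF assms(1,2)] ..

lemma antidiagonal_shift: "x \<in> antidiagonal n \<Longrightarrow> x + adeg C \<in> antidiagonal n"
  by (auto simp: antidiagonal_def adeg_eq)

lemma limit_abutmentD:
  assumes "v \<in> carrier (limit_abutment C n)" "x \<in> antidiagonal n"
  shows "v x \<in> carrier (Dmod C x)" "imap C x (v x) = v (x + adeg C)"
  using assms by (auto simp: limit_abutment_def)

lemma limit_abutmentI:
  assumes "\<And>x. x \<in> antidiagonal n \<Longrightarrow> w x \<in> carrier (Dmod C x)"
    and "\<And>x. x \<in> antidiagonal n \<Longrightarrow> imap C x (w x) = w (x + adeg C)"
  shows "(\<lambda>x\<in>antidiagonal n. w x) \<in> carrier (limit_abutment C n)"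
  using assms antidiagonal_shift by (auto simp: limit_abutment_def)

lemma limit_abutment_add:
  "v \<oplus>\<^bsub>limit_abutment C n\<^esub> w = (\<lambda>x\<in>antidiagonal n. v x \<oplus>\<^bsub>Dmod C x\<^esub> w x)"
  by (simp add: limit_abutment_def)

lemma limit_abutment_zero:
  "\<zero>\<^bsub>limit_abutment C n\<^esub> = (\<lambda>x\<in>antidiagonal n. \<zero>\<^bsub>Dmod C x\<^esub>)"
  by (simp add: limit_abutment_def)

lemma limit_abutment_group: "abelian_group (limit_abutment C n)"
proof -
  have D: "abelian_monoid (Dmod C x)" for x using D_group by (rule abelian_group.axioms)
  show ?thesis
  proof (rule abelian_groupI)
    show "\<zero>\<^bsub>limit_abutment C n\<^esub> \<in> carrier (limit_abutment C n)"
      unfolding limit_abutment_zero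
      by (intro limit_abutmentI abelian_group_hom.hom_zero[OF i_hom] abelian_monoid.zero_closed[OF D])
  next
    fix v assume v: "v \<in> carrier (limit_abutment C n)"
    have ext: "v \<in> extensional (antidiagonal n)"
      using v by (auto simp: limit_abutment_def PiE_def)
    show "\<zero>\<^bsub>limit_abutment C n\<^esub> \<oplus>\<^bsub>limit_abutment C n\<^esub> v = v"
      unfolding limit_abutment_zero limit_abutment_add
      by (rule extensionalityI[OF restrict_extensional ext])
        (simp add: abelian_monoid.l_zero[OF D] limit_abutmentD[OF v])
    have "(\<lambda>x\<in>antidiagonal n. \<ominus>\<^bsub>Dmod C x\<^esub> v x) \<in> carrier (limit_abutment C n)"
      using limit_abutmentD[OF v]
      by (intro limit_abutmentI)
        (simp_all add: abelian_group.a_inv_closed[OF D_group] abelian_group_hom.hom_a_inv[OF i_hom])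
    moreover have "(\<lambda>x\<in>antidiagonal n. \<ominus>\<^bsub>Dmod C x\<^esub> v x) \<oplus>\<^bsub>limit_abutment C n\<^esub> v = \<zero>\<^bsub>limit_abutment C n\<^esub>"
      unfolding limit_abutment_zero limit_abutment_add
      by (rule restrict_ext) (simp add: abelian_group.l_neg[OF D_group] limit_abutmentD[OF v])
    ultimately show "\<exists>w\<in>carrier (limit_abutment C n).
        w \<oplus>\<^bsub>limit_abutment C n\<^esub> v = \<zero>\<^bsub>limit_abutment C n\<^esub>" by blast
    fix w assume w: "w \<in> carrier (limit_abutment C n)"
    show "v \<oplus>\<^bsub>limit_abutment C n\<^esub> w \<in> carrier (limit_abutment C n)"
      unfolding limit_abutment_add using limit_abutmentD[OF v] limit_abutmentD[OF w]
      by (intro limit_abutmentI)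
        (simp_all add: abelian_monoid.a_closed[OF D] abelian_group_hom.hom_add[OF i_hom])
    show "v \<oplus>\<^bsub>limit_abutment C n\<^esub> w = w \<oplus>\<^bsub>limit_abutment C n\<^esub> v"
      unfolding limit_abutment_add
      by (intro restrict_ext abelian_monoid.a_comm[OF D] limit_abutmentD[OF v] limit_abutmentD[OF w])
    fix u assume u: "u \<in> carrier (limit_abutment C n)"
    show "v \<oplus>\<^bsub>limit_abutment C n\<^esub> w \<oplus>\<^bsub>limit_abutment C n\<^esub> u =
        v \<oplus>\<^bsub>limit_abutment C n\<^esub> (w \<oplus>\<^bsub>limit_abutment C n\<^esub> u)"
      unfolding limit_abutment_add
      by (rule restrict_ext) (simp add: abelian_monoid.a_assoc[OF D] limit_abutmentD[OF v]
          limit_abutmentD[OF w] limit_abutmentD[OF u])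
  qed
qed

lemma cone_hom:
  assumes "x \<in> antidiagonal n"
  shows "abelian_group_hom (limit_abutment C n) (Dmod C x) (\<lambda>v. v x)"
  using assms
  by (intro additive_imp_group_hom limit_abutment_group D_group)
    (simp_all add: limit_abutmentD limit_abutment_add)

lemma mem_filtration_iff:
  "v \<in> filtration C t (p, q) \<longleftrightarrow>
     v \<in> carrier (limit_abutment C (p + q)) \<and> v (p + t, q - t) = \<zero>\<^bsub>Dmod C (p + t, q - t)\<^esub>"
  by (simp add: filtration_def a_kernel_def')

lemma filtration_minus_closed:
  assumes "v \<in> filtration C t (p, q)" "w \<in> filtration C t (p, q)"
  shows "v \<ominus>\<^bsub>limit_abutment C (p + q)\<^esub> w \<in> filtration C t (p, q)"
proof -
  interpret L: abelian_group_hom "limit_abutment C (p + q)" "Dmod C (p + t, q - t)"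
    "\<lambda>v. v (p + t, q - t)"
    by (rule cone_hom) (simp add: antidiagonal_def)
  show ?thesis
    using assms L.hom_minus[of v w] by (simp add: mem_filtration_iff a_minus_def)
qed

end

locale matched_couple = first_quadrant_couple R C
  for R :: "('r, 'x) ring_scheme" and C :: "('r, 'd, 'e) couple" +
  fixes t :: int and \<pi> :: "int \<times> int \<Rightarrow> (int \<times> int \<Rightarrow> 'd) \<Rightarrow> 'e set"
  assumes matches: "matches_limit_abutment R C t \<pi>"
begin

lemma filtration_bottom: "n \<ge> 0 \<Longrightarrow> filtration C t (n, 0) = {\<zero>\<^bsub>limit_abutment C n\<^esub>}"
  and filtration_top: "n \<ge> 0 \<Longrightarrow> filtration C t (-1, n + 1) = carrier (limit_abutment C n)"
  using matches by (auto simp: matches_limit_abutment_def)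

context
  fixes p q :: int
  assumes pq: "p \<ge> 0" "q \<ge> 0"
begin

lemma graded_piece:
  "filtration C t (p, q) \<subseteq> filtration C t (p - 1, q + 1)"
  "\<pi> (p, q) \<in> linear_maps R
     (limit_abutment C (p + q) \<lparr> carrier := filtration C t (p - 1, q + 1) \<rparr>) (page_inf C (p, q))"
  "\<pi> (p, q) ` filtration C t (p - 1, q + 1) = carrier (page_inf C (p, q))"
  "a_kernel (limit_abutment C (p + q) \<lparr> carrier := filtration C t (p - 1, q + 1) \<rparr>)
     (page_inf C (p, q)) (\<pi> (p, q)) = filtration C t (p, q)"
proof -
  have "0 \<le> p + q" using pq by simp
  with matches pq show
    "filtration C t (p, q) \<subseteq> filtration C t (p - 1, q + 1)"
    "\<pi> (p, q) \<in> linear_maps R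
       (limit_abutment C (p + q) \<lparr> carrier := filtration C t (p - 1, q + 1) \<rparr>) (page_inf C (p, q))"
    "\<pi> (p, q) ` filtration C t (p - 1, q + 1) = carrier (page_inf C (p, q))"
    "a_kernel (limit_abutment C (p + q) \<lparr> carrier := filtration C t (p - 1, q + 1) \<rparr>)
       (page_inf C (p, q)) (\<pi> (p, q)) = filtration C t (p, q)"
    unfolding matches_limit_abutment_def by blast+
qed

lemmas filtration_step = graded_piece(1) and \<pi>_image = graded_piece(3)

lemma \<pi>_add:
  assumes "v \<in> filtration C t (p - 1, q + 1)" "w \<in> filtration C t (p - 1, q + 1)"
  shows "\<pi> (p, q) (v \<oplus>\<^bsub>limit_abutment C (p + q)\<^esub> w) = \<pi> (p, q) v <+>\<^bsub>Emod C (p, q)\<^esub> \<pi> (p, q) w"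
  using linear_mapsD(2)[OF graded_piece(2), of v w] assms
  by (simp add: page_inf_def subquotient_def)

lemma \<pi>_kernel:
  assumes "v \<in> filtration C t (p - 1, q + 1)"
  shows "\<pi> (p, q) v = Binf C (p, q) \<longleftrightarrow> v \<in> filtration C t (p, q)"
  using graded_piece(4) assms by (auto simp: a_kernel_def' page_inf_def subquotient_def)

text \<open>Additivity of \<open>\<pi>\<close> together with cancellation, carried out on the cosets that form \<open>E\<^sub>\<infinity>\<close>.\<close>

lemma \<pi>_eq_imp_minus:
  assumes v: "v \<in> filtration C t (p - 1, q + 1)" and w: "w \<in> filtration C t (p - 1, q + 1)"
    and eq: "\<pi> (p, q) v = \<pi> (p, q) w"
  shows "v \<ominus>\<^bsub>limit_abutment C (p + q)\<^esub> w \<in> filtration C t (p, q)"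
proof -
  \<comment> \<open>An index so large that \<open>E\<^sub>\<infinity>\<close> at \<open>(p, q)\<close> is page \<open>m + 1\<close>.\<close>
  define m where "m = nat (p + q + 1)"
  have m: "m \<ge> 1" "p \<le> int m" "q < int m" using pq by (auto simp: m_def)
  interpret L: abelian_group "limit_abutment C (p + q)" by (rule limit_abutment_group)
  interpret B: abelian_subgroup "Bsub C m (p, q)" "Emod C (p, q)"
    by (rule submodule_abelian_subgroup[OF Bsub_submodule E_group])
  define u where "u = v \<ominus>\<^bsub>limit_abutment C (p + q)\<^esub> w"
  have vw: "v \<in> carrier (limit_abutment C (p + q))" "w \<in> carrier (limit_abutment C (p + q))"
    using v w by (simp_all add: mem_filtration_iff)
  have u: "u \<in> filtration C t (p - 1, q + 1)"
    using filtration_minus_closed[OF v w] by (simp add: u_def)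
  have "v = u \<oplus>\<^bsub>limit_abutment C (p + q)\<^esub> w"
    using vw by (simp add: u_def a_minus_def L.a_assoc L.l_neg)
  then have sum: "\<pi> (p, q) u <+>\<^bsub>Emod C (p, q)\<^esub> \<pi> (p, q) w = \<pi> (p, q) w"
    using \<pi>_add[OF u w] eq by simp
  have "\<pi> (p, q) u \<in> carrier (page C (Suc m) (p, q))" "\<pi> (p, q) w \<in> carrier (page C (Suc m) (p, q))"
    using \<pi>_image u w page_inf_eq[OF m] by auto
  then obtain x y where "x \<in> Zsub C m (p, q)" "y \<in> Zsub C m (p, q)" and xy:
    "\<pi> (p, q) u = Bsub C m (p, q) +>\<^bsub>Emod C (p, q)\<^esub> x"
    "\<pi> (p, q) w = Bsub C m (p, q) +>\<^bsub>Emod C (p, q)\<^esub> y"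
    by (auto simp: page_Suc subquotient_def)
  then have xy': "x \<in> carrier (Emod C (p, q))" "y \<in> carrier (Emod C (p, q))"
    using Z_carrier by blast+
  have "(x \<oplus>\<^bsub>Emod C (p, q)\<^esub> y) \<ominus>\<^bsub>Emod C (p, q)\<^esub> y \<in> Bsub C m (p, q)"
    using sum xy xy' by (simp add: B.a_rcos_sum B.coset_eq_iff)
  then have "x \<in> Bsub C m (p, q)" using xy xy' by (simp add: a_minus_def B.a_assoc B.r_neg)
  then have "\<pi> (p, q) u = Binf C (p, q)" using xy xy' by (simp add: B.a_rcos_const Binf_eq[OF m(1,2)])
  then show ?thesis using \<pi>_kernel[OF u] by (simp add: u_def)
qed

end

end

locale matched_morphism = first_quadrant_morphism R C1 C2 f g +
  C1: matched_couple R C1 t \<pi>1 + C2: matched_couple R C2 t \<pi>2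
  for R :: "('r, 'x) ring_scheme"
    and C1 :: "('r, 'd1, 'e1) couple" and C2 :: "('r, 'd2, 'e2) couple" and f g t \<pi>1 \<pi>2 +
  assumes compatible: "\<And>p q v. p \<ge> 0 \<Longrightarrow> q \<ge> 0 \<Longrightarrow> v \<in> filtration C1 t (p - 1, q + 1) \<Longrightarrow>
      \<pi>2 (p, q) (limit_map f (p + q) v) = page_inf_map C2 g (p, q) (\<pi>1 (p, q) v)"
    and limit_iso: "\<And>n. linear_iso R (limit_abutment C1 n) (limit_abutment C2 n) (limit_map f n)"
begin

lemma limit_hom: "abelian_group_hom (limit_abutment C1 n) (limit_abutment C2 n) (limit_map f n)"
  using limit_iso
  by (auto simp: linear_iso_def
      intro!: linear_maps_group_hom C1.limit_abutment_group C2.limit_abutment_group)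

lemma limit_map_filtration:
  assumes "v \<in> filtration C1 t (p, q)" shows "limit_map f (p + q) v \<in> filtration C2 t (p, q)"
  using assms abelian_group_hom.hom_closed[OF limit_hom] abelian_group_hom.hom_zero[OF f_hom]
  by (auto simp: C1.mem_filtration_iff C2.mem_filtration_iff limit_map_def antidiagonal_def)

text \<open>Each step of the filtration is mapped into the corresponding step by naturality of the cone
  maps; the open question is always whether it is mapped onto it.\<close>

definition filtration_surj :: "int \<times> int \<Rightarrow> bool" where
  "filtration_surj x \<longleftrightarrow>
     filtration C2 t x \<subseteq> limit_map f (fst x + snd x) ` filtration C1 t x"

context
  fixes p q :: int and m :: nat
  assumes pq: "p \<ge> 0" "q \<ge> 0" and m: "m \<ge> 1" "p \<le> int m" "q < int m"
begin

lemma compatible_page: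
  assumes "v \<in> filtration C1 t (p - 1, q + 1)"
  shows "\<pi>2 (p, q) (limit_map f (p + q) v) = page_map C2 g (Suc m) (p, q) (\<pi>1 (p, q) v)"
  using compatible[OF pq assms] C2.Binf_eq[OF m(1,2)] by (simp add: page_inf_map_def page_map_def)

text \<open>The surjective half of the five lemma for \<open>0 \<rightarrow> F\<^sup>p\<^sup>,\<^sup>q \<rightarrow> F\<^sup>p\<^sup>-\<^sup>1\<^sup>,\<^sup>q\<^sup>+\<^sup>1 \<rightarrow> E\<^sub>\<infinity>\<^sup>p\<^sup>,\<^sup>q \<rightarrow> 0\<close>.\<close>

lemma filtration_surj_step:
  assumes surj: "page_surj m (p, q)" and F: "filtration_surj (p, q)"
  shows "filtration_surj (p - 1, q + 1)"
  unfolding filtration_surj_def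
proof
  interpret L: abelian_group_hom "limit_abutment C1 (p + q)" "limit_abutment C2 (p + q)"
    "limit_map f (p + q)" by (rule limit_hom)
  fix v assume v: "v \<in> filtration C2 t (p - 1, q + 1)"
  then have "\<pi>2 (p, q) v \<in> carrier (page C2 (Suc m) (p, q))"
    using C2.\<pi>_image[OF pq] C2.page_inf_eq[OF m] by auto
  then obtain X where X: "X \<in> carrier (page C1 (Suc m) (p, q))"
    "\<pi>2 (p, q) v = page_map C2 g (Suc m) (p, q) X"
    using surj by (auto simp: page_surj_image)
  then obtain w where w: "w \<in> filtration C1 t (p - 1, q + 1)" "X = \<pi>1 (p, q) w"
    using C1.\<pi>_image[OF pq] C1.page_inf_eq[OF m] by (metis imageE)
  have Lw: "limit_map f (p + q) w \<in> filtration C2 t (p - 1, q + 1)"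
    using limit_map_filtration[OF w(1)] by simp
  have "v \<ominus>\<^bsub>limit_abutment C2 (p + q)\<^esub> limit_map f (p + q) w \<in> filtration C2 t (p, q)"
    using C2.\<pi>_eq_imp_minus[OF pq v Lw] X(2) w compatible_page by simp
  then obtain u where u: "u \<in> filtration C1 t (p, q)"
    "v \<ominus>\<^bsub>limit_abutment C2 (p + q)\<^esub> limit_map f (p + q) w = limit_map f (p + q) u"
    using F unfolding filtration_surj_def by auto
  have u': "u \<in> filtration C1 t (p - 1, q + 1)" using u(1) C1.filtration_step[OF pq] by blast
  have c: "v \<in> carrier (limit_abutment C2 (p + q))" "w \<in> carrier (limit_abutment C1 (p + q))"
    "u \<in> carrier (limit_abutment C1 (p + q))"
    using v w u by (auto simp: C1.mem_filtration_iff C2.mem_filtration_iff)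
  \<comment> \<open>Closure under sums is derived from closure under differences: \<open>- w = (w - w) - w\<close>.\<close>
  have "\<ominus>\<^bsub>limit_abutment C1 (p + q)\<^esub> w \<in> filtration C1 t (p - 1, q + 1)"
    using C1.filtration_minus_closed[OF C1.filtration_minus_closed[OF w(1) w(1)] w(1)] c
    by (simp add: a_minus_def L.G.r_neg)
  then have "u \<oplus>\<^bsub>limit_abutment C1 (p + q)\<^esub> w \<in> filtration C1 t (p - 1, q + 1)"
    using C1.filtration_minus_closed[OF u', of "\<ominus>\<^bsub>limit_abutment C1 (p + q)\<^esub> w"] c
    by (simp add: a_minus_def)
  moreover have "v = limit_map f (p + q) (u \<oplus>\<^bsub>limit_abutment C1 (p + q)\<^esub> w)"
    using c u(2)[symmetric] by (simp add: a_minus_def L.H.a_assoc L.H.l_neg)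
  ultimately show "v \<in> limit_map f (fst (p - 1, q + 1) + snd (p - 1, q + 1)) `
      filtration C1 t (p - 1, q + 1)" by simp
qed

lemma page_surj_of_filtration:
  assumes F: "filtration_surj (p - 1, q + 1)" shows "page_surj m (p, q)"
proof -
  have "X \<in> page_map C2 g (Suc m) (p, q) ` carrier (page C1 (Suc m) (p, q))"
    if X: "X \<in> carrier (page C2 (Suc m) (p, q))" for X
  proof -
    obtain v where v: "v \<in> filtration C2 t (p - 1, q + 1)" "X = \<pi>2 (p, q) v"
      using X C2.\<pi>_image[OF pq] C2.page_inf_eq[OF m] by (metis imageE)
    obtain w where w: "w \<in> filtration C1 t (p - 1, q + 1)" "v = limit_map f (p + q) w"
      using F v(1) by (auto simp: filtration_surj_def)
    have "\<pi>1 (p, q) w \<in> carrier (page C1 (Suc m) (p, q))"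
      using w C1.\<pi>_image[OF pq] C1.page_inf_eq[OF m] by auto
    then show ?thesis using v w compatible_page by auto
  qed
  moreover have "page_map C2 g (Suc m) (p, q) ` carrier (page C1 (Suc m) (p, q))
      \<subseteq> carrier (page C2 (Suc m) (p, q))"
    using subquotient_hom.coset_map_linear[OF page_hom]
    by (auto simp: page_map_def C1.page_Suc C2.page_Suc dest: linear_mapsD(1))
  ultimately show ?thesis unfolding page_surj_image by blast
qed

text \<open>If \<open>v\<close> represents a class that dies in the second couple, then its image lies in \<open>F\<^sup>p\<^sup>,\<^sup>q\<close>, so it is
  also the image of some \<open>u\<close> in \<open>F\<^sup>p\<^sup>,\<^sup>q\<close>. As \<open>L\<^sup>p\<^sup>+\<^sup>q\<close> maps injectively, \<open>v = u\<close>, and the class was zero.\<close>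

lemma page_inj_of_filtration:
  assumes F: "filtration_surj (p, q)" shows "page_inj m (p, q)"
  unfolding page_inj_def inj_mod_def
proof (intro ballI impI)
  interpret B: abelian_subgroup "Bsub C1 m (p, q)" "Emod C1 (p, q)"
    by (rule submodule_abelian_subgroup[OF C1.Bsub_submodule C1.E_group])
  interpret B': abelian_subgroup "Bsub C2 m (p, q)" "Emod C2 (p, q)"
    by (rule submodule_abelian_subgroup[OF C2.Bsub_submodule C2.E_group])
  fix z assume z: "z \<in> Zsub C1 m (p, q)" "g (p, q) z \<in> Bsub C2 m (p, q)"
  have zc: "z \<in> carrier (Emod C1 (p, q))" using z(1) by (rule C1.Z_carrier)
  have "page_class C1 (Suc m) (p, q) z \<in> carrier (page C1 (Suc m) (p, q))"
    using z(1) by (auto simp: C1.page_Suc subquotient_def page_class_def)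
  then obtain v where v: "v \<in> filtration C1 t (p - 1, q + 1)"
    "page_class C1 (Suc m) (p, q) z = \<pi>1 (p, q) v"
    using C1.\<pi>_image[OF pq] C1.page_inf_eq[OF m] by (metis imageE)
  have Lv: "limit_map f (p + q) v \<in> filtration C2 t (p - 1, q + 1)"
    using limit_map_filtration[OF v(1)] by simp
  have "\<pi>2 (p, q) (limit_map f (p + q) v) = page_class C2 (Suc m) (p, q) (g (p, q) z)"
    using compatible_page[OF v(1)] page_map_class[OF zc] by (simp flip: v(2))
  also have "\<dots> = Binf C2 (p, q)"
    using z(2) C2.Binf_eq[OF m(1,2)] by (simp add: page_class_def B'.a_rcos_const)
  finally have "limit_map f (p + q) v \<in> filtration C2 t (p, q)"
    using C2.\<pi>_kernel[OF pq Lv] by simp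
  then obtain u where u: "u \<in> filtration C1 t (p, q)" "limit_map f (p + q) v = limit_map f (p + q) u"
    using F by (auto simp: filtration_surj_def)
  have "inj_on (limit_map f (p + q)) (carrier (limit_abutment C1 (p + q)))"
    using limit_iso by (simp add: linear_iso_def bij_betw_def)
  then have "v = u"
    using u v(1) by (auto simp: C1.mem_filtration_iff dest: inj_onD)
  then have "page_class C1 (Suc m) (p, q) z = Bsub C1 m (p, q)"
    using C1.\<pi>_kernel[OF pq v(1)] u(1) v(2) C1.Binf_eq[OF m(1,2)] by simp
  then show "z \<in> Bsub C1 m (p, q)" using zc by (simp add: page_class_def B.coset_eq_self_iff)
qed

end

lemma filtration_surj_top:
  assumes "n \<ge> 0" shows "filtration_surj (-1, n + 1)"
  using limit_iso[of n] C1.filtration_top[OF assms] C2.filtration_top[OF assms]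
  by (simp add: filtration_surj_def linear_iso_def bij_betw_def)

text \<open>The filtration of \<open>L\<^sup>n\<close> is climbed from \<open>F\<^sup>n\<^sup>,\<^sup>0 = 0\<close> up to row \<open>q\<close>; on the way it meets only
  quotients \<open>E\<^sub>\<infinity>\<close> in rows below \<open>q\<close>.\<close>

lemma filtration_surj_below:
  assumes q: "0 \<le> q" "q \<le> n"
    and surj: "\<And>q' m. 0 \<le> q' \<Longrightarrow> q' < q \<Longrightarrow> m \<ge> 1 \<Longrightarrow> page_surj m (n - q', q')"
  shows "filtration_surj (n - q, q)"
proof -
  have "int k \<le> q \<Longrightarrow> filtration_surj (n - int k, int k)" for k
  proof (induction k)
    case 0
    interpret L: abelian_group_hom "limit_abutment C1 n" "limit_abutment C2 n" "limit_map f n"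
      by (rule limit_hom)
    show ?case using C1.filtration_bottom[of n] C2.filtration_bottom[of n] q
      by (simp add: filtration_surj_def)
  next
    case (Suc k)
    then have "filtration_surj (n - int k - 1, int k + 1)"
      using q by (intro filtration_surj_step[where m = "nat (n + 1)"] surj) auto
    then show ?case by (simp add: algebra_simps)
  qed
  from this[of "nat q"] show ?thesis using q by simp
qed

text \<open>The inductive step, with both directions of the argument at the top: from page 2 to
  \<open>E\<^sub>\<infinity>\<close> by \<open>page_rows\<close>, then through the abutment, then back to page 2 at \<open>(0, n + 1)\<close>.\<close>

lemma corner_of_next_row:
  assumes n: "n \<ge> 0"
    and iso: "\<And>p q. q \<le> n \<Longrightarrow> page_surj 1 (p, q) \<and> page_inj 1 (p, q)"
  shows "page_surj 1 (0, n + 1) \<and> page_inj 1 (0, n + 1)"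
proof -
  note surj = page_rows(1)[OF iso] and inj = page_rows(2)[OF iso]
  \<comment> \<open>The target of the differential \<open>d\<^sub>m\<^sub>+\<^sub>1\<close> from \<open>(0, n + 1)\<close> has total degree \<open>n + 2\<close>. The map is injective
    there at infinity, and from page \<open>m + 2\<close> on nothing enters this position any more, so the descent reaches that page.\<close>
  have inj_target: "page_inj (Suc m) (int m + 1, n + 1 - int m)" if m: "m \<ge> 1" for m
  proof (cases "n + 1 - int m < 0")
    case True then show ?thesis by (intro page_iso_outside) auto
  next
    case False
    define M where "M = nat (n + 2) + Suc m"
    have "filtration_surj (n + 2 - (n + 1 - int m), n + 1 - int m)"
      using False m by (intro filtration_surj_below surj) auto
    moreover have "n + 2 - (n + 1 - int m) = int m + 1" by simp
    ultimately have "filtration_surj (int m + 1, n + 1 - int m)" by (simp only:)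
    then have "page_inj M (int m + 1, n + 1 - int m)"
      using False n by (intro page_inj_of_filtration) (auto simp: M_def)
    then show ?thesis
    proof (rule inc_induct[of "Suc m" M, rotated])
      fix k assume k: "Suc m \<le> k" "page_inj (Suc k) (int m + 1, n + 1 - int m)"
      show "page_inj k (int m + 1, n + 1 - int m)"
        by (rule page_inj_descend[OF k(2)])
          (use k in \<open>auto simp: C1.diff_deg_quadrant intro!: inj C1.Bsub_stable_column\<close>)
    qed (simp add: M_def)
  qed
  define M where "M = nat (n + 2)"
  have M: "M \<ge> 1" "0 \<le> int M" "n + 1 < int M" using n by (auto simp: M_def)
  have "filtration_surj (n + 1 - (n + 1), n + 1)"
    using n by (intro filtration_surj_below surj) auto
  then have "page_surj M (0, n + 1) \<and> page_inj M (0, n + 1)"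
    using n M filtration_surj_top[of "n + 1"]
    by (auto intro!: page_surj_of_filtration page_inj_of_filtration)
  then show ?thesis
  proof (rule inc_induct[of 1 M, rotated])
    fix k assume k: "1 \<le> k" "page_surj (Suc k) (0, n + 1) \<and> page_inj (Suc k) (0, n + 1)"
    have "page_inj k (0, n + 1)"
      by (rule page_inj_descend)
        (use k in \<open>auto simp: C1.diff_deg_quadrant intro!: inj C1.Bsub_stable_column\<close>)
    moreover have "page_surj k (0, n + 1)"
    proof (rule page_surj_descend)
      show "page_inj (Suc k) ((0, n + 1) + diff_deg C1 (Suc k))"
        using k inj_target[of k] by (simp add: C1.diff_deg_quadrant algebra_simps)
    qed (use k in \<open>auto simp: C1.diff_deg_quadrant intro!: inj surj C2.Bsub_stable_column\<close>)
    ultimately show "page_surj k (0, n + 1) \<and> page_inj k (0, n + 1)" by simp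
  qed (use M in simp)
qed

end

section \<open>The comparison theorem\<close>

theorem theorem2p6p9:
  fixes R :: "('r, 'x) ring_scheme"
    and C1 :: "('r, 'd1, 'e1) couple" and C2 :: "('r, 'd2, 'e2) couple"
    and f :: "int \<times> int \<Rightarrow> 'd1 \<Rightarrow> 'd2" and g :: "int \<times> int \<Rightarrow> 'e1 \<Rightarrow> 'e2"
    and t :: int
    and \<pi>1 :: "int \<times> int \<Rightarrow> (int \<times> int \<Rightarrow> 'd1) \<Rightarrow> 'e1 set"
    and \<pi>2 :: "int \<times> int \<Rightarrow> (int \<times> int \<Rightarrow> 'd2) \<Rightarrow> 'e2 set"
  assumes morphism: "exact_couple_morphism R C1 C2 f g"
    and quadrant1: "\<And>r p q. r \<ge> 2 \<Longrightarrow> p < 0 \<or> q < 0 \<Longrightarrow> zero_module (page C1 r (p, q))"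
    and quadrant2: "\<And>r p q. r \<ge> 2 \<Longrightarrow> p < 0 \<or> q < 0 \<Longrightarrow> zero_module (page C2 r (p, q))"
    and bidegree1: "\<And>r. r \<ge> 2 \<Longrightarrow> diff_deg C1 r = (int r, - int r + 1)"
    and bidegree2: "\<And>r. r \<ge> 2 \<Longrightarrow> diff_deg C2 r = (int r, - int r + 1)"
    and abutment1: "matches_limit_abutment R C1 t \<pi>1"
    and abutment2: "matches_limit_abutment R C2 t \<pi>2"
    and compatible: "\<And>p q v. p \<ge> 0 \<Longrightarrow> q \<ge> 0 \<Longrightarrow> v \<in> filtration C1 t (p - 1, q + 1) \<Longrightarrow>
           \<pi>2 (p, q) (limit_map f (p + q) v) = page_inf_map C2 g (p, q) (\<pi>1 (p, q) v)"
    and limit_iso: "\<And>n. linear_iso R (limit_abutment C1 n) (limit_abutment C2 n) (limit_map f n)"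
    and corner_iso: "linear_iso R (page C1 2 (0, 0)) (page C2 2 (0, 0)) (page_map C2 g 2 (0, 0))"
    and propagation: "\<And>n :: int. n \<ge> 0 \<Longrightarrow>
           (\<forall>q. 0 \<le> q \<and> q \<le> n \<longrightarrow>
              linear_iso R (page C1 2 (0, q)) (page C2 2 (0, q)) (page_map C2 g 2 (0, q))) \<Longrightarrow>
           (\<forall>p q. q \<le> n \<longrightarrow>
              linear_iso R (page C1 2 (p, q)) (page C2 2 (p, q)) (page_map C2 g 2 (p, q)))"
  shows "spectral_sequence_iso R C1 C2 2 (page_map C2 g)"
proof -
  interpret exact_couple_morphism R C1 C2 f g by (rule morphism)
  interpret matched_morphism R C1 C2 f g t \<pi>1 \<pi>2
    by unfold_locales (fact quadrant1 quadrant2 bidegree1 bidegree2 abutment1 abutment2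
        compatible limit_iso)+
  have two: "linear_iso R (page C1 2 x) (page C2 2 x) (page_map C2 g 2 x)
      \<longleftrightarrow> page_surj 1 x \<and> page_inj 1 x" for x
    using page_iso_iff[of 1 x] by (simp add: numeral_2_eq_2)
  have rows_iso: "\<forall>p q. q \<le> int k \<longrightarrow> page_surj 1 (p, q) \<and> page_inj 1 (p, q)" for k
  proof (induction k)
    case 0
    have "\<forall>q. 0 \<le> q \<and> q \<le> (0::int) \<longrightarrow> page_surj 1 (0, q) \<and> page_inj 1 (0, q)"
      using corner_iso unfolding two by (auto dest: antisym)
    from propagation[of 0, unfolded two, OF _ this] show ?case by simp
  next
    case (Suc k)
    have "page_surj 1 (0, int k + 1) \<and> page_inj 1 (0, int k + 1)"
      using Suc by (intro corner_of_next_row) auto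
    then have "\<forall>q. 0 \<le> q \<and> q \<le> int (Suc k) \<longrightarrow> page_surj 1 (0, q) \<and> page_inj 1 (0, q)"
      using Suc by (metis of_nat_Suc add.commute zle_add1_eq_le order_le_less)
    from propagation[of "int (Suc k)", unfolded two, OF _ this] show ?case by simp
  qed
  \<comment> \<open>Rows \<open>q < 0\<close> are covered by \<open>nat q = 0\<close>.\<close>
  have iso: "page_surj 1 (p, q) \<and> page_inj 1 (p, q)" for p q
    using rows_iso[of "nat q"] by simp
  have "linear_iso R (page C1 r x) (page C2 r x) (page_map C2 g r x)" if r: "r \<ge> 2" for r x
  proof -
    obtain m p q where "r = Suc m" "m \<ge> 1" "x = (p, q)" using r by (cases r; cases x) auto
    then show ?thesis
      \<comment> \<open>Any bound on the rows is available now; this one puts row \<open>q\<close> of page \<open>m + 1\<close> in range.\<close>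
      using page_rows[of "q + int m", OF iso] by (simp add: page_iso_iff)
  qed
  then show ?thesis
    unfolding spectral_sequence_iso_def using page_map_morphism[of 2] by simp
qed

end
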